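(* Let $k=\mathbb F(q)$ and $k^*=k\setminus\{0\}$. For every $\mathbf c=(c_1,\dots,c_{m+n})\in(k^* )^{m+n}$ there exists a unique (up to isomorphism) simple $U_q$-module of highest weight $\mathbf c$, and this module contains a unique (up to scalar multiple) maximal vector.
   Context: Let $m,n\ge1$, $\mathbb F$ a field of characteristic $0$, $q$ an indeterminate, $q_i=q$ for $i\le m$ and $q_i=q^{-1}$ for $i>m$. $U_q=U_q(\mathfrak{gl}(m,n))$ is the associative unital $\mathbb F(q)$-superalgebra with generators $E_{i,i+1},F_{i,i+1}$ ($1\le i<m+n$), $K_j^{\pm1}$ ($1\le j\le m+n$), where $E_{m,m+1},F_{m,m+1}$ are odd and all other generators even, and relations (with $[x,y]=xy-(-1)^{\bar x\bar y}yx$; relations with out-of-range indices are omitted) (R1) $K_iK_j=K_jK_i$, $K_iK_i^{-1}=K_i^{-1}K_i=1$; (R2) $K_iE_{j,j+1}K_i^{-1}=q_i^{\delta_{ij}-\delta_{i,j+1}}E_{j,j+1}$, $K_iF_{j,j+1}K_i^{-1}=q_i^{-(\delta_{ij}-\delta_{i,j+1})}F_{j,j+1}$; (R3) $[E_{i,i+1},F_{j,j+1}]=\delta_{ij}\dfrac{K_iK_{i+1}^{-1}-K_i^{-1}K_{i+1}}{q_i-q_i^{-1}}$; (R4) $E_{m,m+1}^2=F_{m,m+1}^2=0$; (R5) $E_{i,i+1}E_{j,j+1}=E_{j,j+1}E_{i,i+1}$, $F_{i,i+1}F_{j,j+1}=F_{j,j+1}F_{i,i+1}$ if $|i-j|>1$;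 (R6) $E_{i,i+1}^2E_{j,j+1}-(q+q^{-1})E_{i,i+1}E_{j,j+1}E_{i,i+1}+E_{j,j+1}E_{i,i+1}^2=0$ if $|i-j|=1$, $i\ne m$; (R7) the same as (R6) with $F$ in place of $E$; (R8) $[E_{m-1,m+2},E_{m,m+1}]=[F_{m-1,m+2},F_{m,m+1}]=0$, where for $i<c<j$, $E_{ij}=E_{ic}E_{cj}-q_c^{-1}E_{cj}E_{ic}$ and $F_{ij}=-q_cF_{ic}F_{cj}+F_{cj}F_{ic}$ (independent of $c$). Modules $M=M_{\bar0}\oplus M_{\bar1}$ and their submodules are $\mathbb Z_2$-graded; "simple" means having no proper nonzero graded submodule; isomorphisms are $U_q$-linear bijections that may preserve or interchange the two parities. For $\mathbf c\in(k^* )^{m+n}$, $M_{\mathbf c}=\{x\in M: K_ix=c_ix,\ 1\le i\le m+n\}$. A nonzero homogeneous element $x$ of some $M_{\mathbf c}$ is a maximal vector (of weight $\mathbf c$) if $E_{i,i+1}x=0$ for all $1\le i<m+n$. $M$ is a highest weight module of highest weight $\mathbf c$ if it is generated by a maximal vector $x\in M_{\mathbf c}$. *)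

theory Defs
  imports
    "HOL-Algebra.QuotRing"
    "HOL-Algebra.Module"
    "HOL-Library.Poly_Mapping"
    "HOL-Library.Z2"
    "HOL-Computational_Algebra.Fraction_Field"
    "HOL-Computational_Algebra.Polynomial"
begin

section \<open>Noncommutative polynomials\<close>

datatype 'g word = Word (letters: "'g list")

instantiation word :: (type) monoid_add
begin

definition zero_word :: "'a word" where
  "0 = Word []"

definition plus_word :: "'a word \<Rightarrow> 'a word \<Rightarrow> 'a word" where
  "v + w = Word (letters v @ letters w)"

instance
  by standard (auto simp: zero_word_def plus_word_def)

end

text \<open>Words carry the concatenation monoid, written additively, so that
  \<^typ>\<open>'g word \<Rightarrow>\<^sub>0 'k::ring_1\<close> with the convolution product is the free unital algebra
  on \<^typ>\<open>'g\<close>.\<close>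

definition scalar :: "'k \<Rightarrow> ('g word \<Rightarrow>\<^sub>0 'k::ring_1)" where
  "scalar a = Poly_Mapping.single 0 a"

definition var :: "'g \<Rightarrow> ('g word \<Rightarrow>\<^sub>0 'k::ring_1)" where
  "var g = Poly_Mapping.single (Word [g]) 1"


section \<open>The free superalgebra\<close>

text \<open>\<open>GE i\<close> and \<open>GF i\<close> stand for $E_{i,i+1}$ and $F_{i,i+1}$, \<open>GKi i\<close> for $K_i^{-1}$.\<close>

datatype gen = GE nat | GF nat | GK nat | GKi nat

definition gens :: "nat \<Rightarrow> nat \<Rightarrow> gen set" where
  "gens m n = GE ` {1..<m+n} \<union> GF ` {1..<m+n} \<union> GK ` {1..m+n} \<union> GKi ` {1..m+n}"

fun gen_parity :: "nat \<Rightarrow> gen \<Rightarrow> bit" where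
  "gen_parity m (GE i) = of_bool (i = m)"
| "gen_parity m (GF i) = of_bool (i = m)"
| "gen_parity m (GK i) = 0"
| "gen_parity m (GKi i) = 0"

definition word_parity :: "nat \<Rightarrow> gen word \<Rightarrow> bit" where
  "word_parity m w = sum_list (map (gen_parity m) (letters w))"

type_synonym 'f ratfun = "'f poly fract"
type_synonym 'f free = "gen word \<Rightarrow>\<^sub>0 'f ratfun"

definition free_alg :: "nat \<Rightarrow> nat \<Rightarrow> 'f::field_char_0 free ring" where
  "free_alg m n =
     \<lparr>carrier = {p. \<forall>w\<in>Poly_Mapping.keys p. set (letters w) \<subseteq> gens m n},
      monoid.mult = (*), one = 1, zero = 0, add = (+)\<rparr>"

definition free_part :: "nat \<Rightarrow> nat \<Rightarrow> bit \<Rightarrow> 'f::field_char_0 free set" where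
  "free_part m n p =
     {x \<in> carrier (free_alg m n). \<forall>w\<in>Poly_Mapping.keys x. word_parity m w = p}"


section \<open>The quantum superalgebra\<close>

definition qq :: "'f::field_char_0 ratfun" where
  "qq = Fraction_Field.Fract [:0, 1:] 1"

definition qi :: "nat \<Rightarrow> nat \<Rightarrow> 'f::field_char_0 ratfun" where
  "qi m i = (if i \<le> m then qq else inverse qq)"

text \<open>$[x,y] = xy - (-1)^{ab}yx$ for \<open>x\<close> of parity \<open>a\<close> and \<open>y\<close> of parity \<open>b\<close>.\<close>

definition scomm :: "bit \<Rightarrow> bit \<Rightarrow> 'a::ring_1 \<Rightarrow> 'a \<Rightarrow> 'a" where
  "scomm a b x y = (if a = 1 \<and> b = 1 then x * y + y * x else x * y - y * x)"

text \<open>The root vectors $E_{ij}$ and $F_{ij}$ for \<open>i < j\<close> are taken with \<open>c = j - 1\<close>. In the quotient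
  the choice of \<open>c\<close> is immaterial; for the only ones used in the relations, $E_{m-1,m+2}$ and
  $F_{m-1,m+2}$, this follows from the commutation of the outer two of the three simple root
  vectors.\<close>

function root_E :: "nat \<Rightarrow> nat \<Rightarrow> nat \<Rightarrow> 'f::field_char_0 free" where
  "root_E m i j =
     (if j \<le> i + 1 then var (GE i)
      else let c = j - 1 in
        root_E m i c * root_E m c j - scalar (inverse (qi m c)) * root_E m c j * root_E m i c)"
  by auto
termination by (relation "measure (\<lambda>(m, i, j). j - i)") auto

function root_F :: "nat \<Rightarrow> nat \<Rightarrow> nat \<Rightarrow> 'f::field_char_0 free" where
  "root_F m i j =
     (if j \<le> i + 1 then var (GF i)
      else let c = j - 1 in
        - scalar (qi m c) * root_F m i c * root_F m c j + root_F m c j * root_F m i c)"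
  by auto
termination by (relation "measure (\<lambda>(m, i, j). j - i)") auto

declare root_E.simps [simp del] root_F.simps [simp del]

text \<open>The exponent $\delta_{ij} - \delta_{i,j+1}$ and the right-hand side of $[E_{i,i+1},F_{i,i+1}]$.\<close>

definition wt :: "nat \<Rightarrow> nat \<Rightarrow> int" where
  "wt i j = of_bool (i = j) - of_bool (i = j + 1)"

definition cartan :: "nat \<Rightarrow> nat \<Rightarrow> 'f::field_char_0 free" where
  "cartan m i = scalar (inverse (qi m i - inverse (qi m i))) *
     (var (GK i) * var (GKi (i+1)) - var (GKi i) * var (GK (i+1)))"

definition serre :: "'f::field_char_0 free \<Rightarrow> 'f free \<Rightarrow> 'f free" where
  "serre x y = x * x * y - scalar (qq + inverse qq) * x * y * x + y * x * x"

text \<open>Each set consists of the differences of the two sides of one family of relations.\<close>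

definition rels_K :: "nat \<Rightarrow> nat \<Rightarrow> 'f::field_char_0 free set" where
  "rels_K m n =
     {var (GK i) * var (GK j) - var (GK j) * var (GK i) | i j. i \<in> {1..m+n} \<and> j \<in> {1..m+n}}
     \<union> {var (GK i) * var (GKi i) - 1 | i. i \<in> {1..m+n}}
     \<union> {var (GKi i) * var (GK i) - 1 | i. i \<in> {1..m+n}}"

definition rels_KEF :: "nat \<Rightarrow> nat \<Rightarrow> 'f::field_char_0 free set" where
  "rels_KEF m n =
     {var (GK i) * var (GE j) * var (GKi i) - scalar (qi m i powi wt i j) * var (GE j)
        | i j. i \<in> {1..m+n} \<and> j \<in> {1..<m+n}}
     \<union> {var (GK i) * var (GF j) * var (GKi i) - scalar (qi m i powi (- wt i j)) * var (GF j)
        | i j. i \<in> {1..m+n} \<and> j \<in> {1..<m+n}}"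

definition rels_EF :: "nat \<Rightarrow> nat \<Rightarrow> 'f::field_char_0 free set" where
  "rels_EF m n =
     {scomm (gen_parity m (GE i)) (gen_parity m (GF j)) (var (GE i)) (var (GF j))
        - (if i = j then cartan m i else 0)
        | i j. i \<in> {1..<m+n} \<and> j \<in> {1..<m+n}}"

definition rels_odd :: "nat \<Rightarrow> 'f::field_char_0 free set" where
  "rels_odd m = {var (GE m) * var (GE m), var (GF m) * var (GF m)}"

definition rels_far :: "nat \<Rightarrow> nat \<Rightarrow> 'f::field_char_0 free set" where
  "rels_far m n =
     {var (X i) * var (X j) - var (X j) * var (X i)
        | X i j. X \<in> {GE, GF} \<and> i \<in> {1..<m+n} \<and> j \<in> {1..<m+n} \<and> \<bar>int i - int j\<bar> > 1}"

definition rels_serre :: "nat \<Rightarrow> nat \<Rightarrow> 'f::field_char_0 free set" where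
  "rels_serre m n =
     {serre (var (X i)) (var (X j))
        | X i j. X \<in> {GE, GF} \<and> i \<in> {1..<m+n} \<and> j \<in> {1..<m+n} \<and> \<bar>int i - int j\<bar> = 1 \<and> i \<noteq> m}"

text \<open>$E_{m-1,m+2}$, $F_{m-1,m+2}$ contain the odd generator once, hence are odd; they exist only if
  \<open>m \<ge> 2\<close> and \<open>n \<ge> 2\<close>.\<close>

definition rels_super :: "nat \<Rightarrow> nat \<Rightarrow> 'f::field_char_0 free set" where
  "rels_super m n =
     (if 2 \<le> m \<and> 2 \<le> n
      then {scomm 1 1 (root_E m (m-1) (m+2)) (var (GE m)),
            scomm 1 1 (root_F m (m-1) (m+2)) (var (GF m))}
      else {})"

definition rels :: "nat \<Rightarrow> nat \<Rightarrow> 'f::field_char_0 free set" where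
  "rels m n = rels_K m n \<union> rels_KEF m n \<union> rels_EF m n \<union> rels_odd m \<union> rels_far m n
     \<union> rels_serre m n \<union> rels_super m n"

definition uq_ideal :: "nat \<Rightarrow> nat \<Rightarrow> 'f::field_char_0 free set" where
  "uq_ideal m n = Idl\<^bsub>free_alg m n\<^esub> (rels m n)"

type_synonym 'f uq = "'f free set"

definition Uq :: "nat \<Rightarrow> nat \<Rightarrow> 'f::field_char_0 uq ring" where
  "Uq m n = free_alg m n Quot uq_ideal m n"

definition cls :: "nat \<Rightarrow> nat \<Rightarrow> 'f::field_char_0 free \<Rightarrow> 'f uq" where
  "cls m n x = uq_ideal m n +>\<^bsub>free_alg m n\<^esub> x"

definition Uq_part :: "nat \<Rightarrow> nat \<Rightarrow> bit \<Rightarrow> 'f::field_char_0 uq set" where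
  "Uq_part m n p = cls m n ` free_part m n p"


section \<open>Modules\<close>

text \<open>The ground field acts on a module through its image in \<^term>\<open>Uq m n\<close>; in particular additive
  maps commuting with \<^term>\<open>Uq m n\<close> are linear. The multiplicative fields of the record \<open>module\<close>,
  inherited from \<open>ring\<close>, play no role.\<close>

record ('u, 'v) supermodule = "('u, 'v) module" +
  part :: "bit \<Rightarrow> 'v set"

locale uq_module = abelian_group M
  for m n :: nat and M :: "('f::field_char_0 uq, 'v) supermodule" (structure) +
  assumes smult_closed: "\<lbrakk>u \<in> carrier (Uq m n); x \<in> carrier M\<rbrakk> \<Longrightarrow> u \<odot> x \<in> carrier M"
    and smult_l_distr: "\<lbrakk>u \<in> carrier (Uq m n); v \<in> carrier (Uq m n); x \<in> carrier M\<rbrakk> \<Longrightarrow>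
      (u \<oplus>\<^bsub>Uq m n\<^esub> v) \<odot> x = u \<odot> x \<oplus> v \<odot> x"
    and smult_r_distr: "\<lbrakk>u \<in> carrier (Uq m n); x \<in> carrier M; y \<in> carrier M\<rbrakk> \<Longrightarrow>
      u \<odot> (x \<oplus> y) = u \<odot> x \<oplus> u \<odot> y"
    and smult_assoc: "\<lbrakk>u \<in> carrier (Uq m n); v \<in> carrier (Uq m n); x \<in> carrier M\<rbrakk> \<Longrightarrow>
      (u \<otimes>\<^bsub>Uq m n\<^esub> v) \<odot> x = u \<odot> (v \<odot> x)"
    and smult_one: "x \<in> carrier M \<Longrightarrow> \<one>\<^bsub>Uq m n\<^esub> \<odot> x = x"
    and part_subgroup: "additive_subgroup (part M p) M"
    and part_sum: "part M 0 <+>\<^bsub>M\<^esub> part M 1 = carrier M"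
    and part_disjoint: "part M 0 \<inter> part M 1 = {\<zero>}"
    and part_smult: "\<lbrakk>u \<in> Uq_part m n a; x \<in> part M b\<rbrakk> \<Longrightarrow> u \<odot> x \<in> part M (a + b)"

definition uq_submodule ::
  "nat \<Rightarrow> nat \<Rightarrow> ('f::field_char_0 uq, 'v) supermodule \<Rightarrow> 'v set \<Rightarrow> bool" where
  "uq_submodule m n M N \<longleftrightarrow>
     additive_subgroup N M
     \<and> (\<forall>u\<in>carrier (Uq m n). \<forall>x\<in>N. u \<odot>\<^bsub>M\<^esub> x \<in> N)
     \<and> N = (N \<inter> part M 0) <+>\<^bsub>M\<^esub> (N \<inter> part M 1)"

text \<open>The zero module is not excluded here; a highest weight module is nonzero in any case.\<close>

definition uq_simple :: "nat \<Rightarrow> nat \<Rightarrow> ('f::field_char_0 uq, 'v) supermodule \<Rightarrow> bool" where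
  "uq_simple m n M \<longleftrightarrow>
     (\<forall>N. uq_submodule m n M N \<longrightarrow> N = {\<zero>\<^bsub>M\<^esub>} \<or> N = carrier M)"

text \<open>Isomorphisms commute with the action without any sign, also when they interchange the
  parities.\<close>

definition uq_iso :: "nat \<Rightarrow> nat \<Rightarrow> ('f::field_char_0 uq, 'v) supermodule \<Rightarrow>
    ('f uq, 'w) supermodule \<Rightarrow> ('v \<Rightarrow> 'w) \<Rightarrow> bool" where
  "uq_iso m n M N f \<longleftrightarrow>
     bij_betw f (carrier M) (carrier N)
     \<and> (\<forall>x\<in>carrier M. \<forall>y\<in>carrier M. f (x \<oplus>\<^bsub>M\<^esub> y) = f x \<oplus>\<^bsub>N\<^esub> f y)
     \<and> (\<forall>u\<in>carrier (Uq m n). \<forall>x\<in>carrier M. f (u \<odot>\<^bsub>M\<^esub> x) = u \<odot>\<^bsub>N\<^esub> f x)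
     \<and> ((\<forall>p. f ` part M p = part N p) \<or> (\<forall>p. f ` part M p = part N (p + 1)))"

definition uq_isomorphic :: "nat \<Rightarrow> nat \<Rightarrow> ('f::field_char_0 uq, 'v) supermodule \<Rightarrow>
    ('f uq, 'w) supermodule \<Rightarrow> bool" where
  "uq_isomorphic m n M N \<longleftrightarrow> (\<exists>f. uq_iso m n M N f)"


section \<open>Highest weight modules\<close>

text \<open>A weight is a function on \<open>{1..m+n}\<close>; values outside this range are irrelevant.\<close>

definition weights :: "nat \<Rightarrow> nat \<Rightarrow> (nat \<Rightarrow> 'f::field_char_0 ratfun) set" where
  "weights m n = {1..m+n} \<rightarrow> UNIV - {0}"

definition weight_space :: "nat \<Rightarrow> nat \<Rightarrow> ('f::field_char_0 uq, 'v) supermodule \<Rightarrow>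
    (nat \<Rightarrow> 'f ratfun) \<Rightarrow> 'v set" where
  "weight_space m n M c =
     {x \<in> carrier M. \<forall>i\<in>{1..m+n}. cls m n (var (GK i)) \<odot>\<^bsub>M\<^esub> x = cls m n (scalar (c i)) \<odot>\<^bsub>M\<^esub> x}"

definition maximal_vector_of_weight :: "nat \<Rightarrow> nat \<Rightarrow> ('f::field_char_0 uq, 'v) supermodule \<Rightarrow>
    (nat \<Rightarrow> 'f ratfun) \<Rightarrow> 'v \<Rightarrow> bool" where
  "maximal_vector_of_weight m n M c x \<longleftrightarrow>
     x \<in> weight_space m n M c \<and> x \<noteq> \<zero>\<^bsub>M\<^esub> \<and> (\<exists>p. x \<in> part M p)
     \<and> (\<forall>i\<in>{1..<m+n}. cls m n (var (GE i)) \<odot>\<^bsub>M\<^esub> x = \<zero>\<^bsub>M\<^esub>)"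

definition maximal_vector ::
  "nat \<Rightarrow> nat \<Rightarrow> ('f::field_char_0 uq, 'v) supermodule \<Rightarrow> 'v \<Rightarrow> bool" where
  "maximal_vector m n M x \<longleftrightarrow> (\<exists>c\<in>weights m n. maximal_vector_of_weight m n M c x)"

definition highest_weight_module :: "nat \<Rightarrow> nat \<Rightarrow> (nat \<Rightarrow> 'f ratfun) \<Rightarrow>
    ('f::field_char_0 uq, 'v) supermodule \<Rightarrow> bool" where
  "highest_weight_module m n c M \<longleftrightarrow> uq_module m n M \<and>
     (\<exists>x. maximal_vector_of_weight m n M c x
        \<and> carrier M = (\<lambda>u. u \<odot>\<^bsub>M\<^esub> x) ` carrier (Uq m n))"


section \<open>Well-formedness of the presentation\<close>

lemma free_alg_simps [simp]:
  "monoid.mult (free_alg m n) = (*)" "one (free_alg m n) = 1"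
  "zero (free_alg m n) = 0" "add (free_alg m n) = (+)"
  by (simp_all add: free_alg_def)

lemma free_alg_memI:
  "(\<And>w. w \<in> Poly_Mapping.keys p \<Longrightarrow> set (letters w) \<subseteq> gens m n) \<Longrightarrow> p \<in> carrier (free_alg m n)"
  by (simp add: free_alg_def)

lemma free_alg_memD:
  "\<lbrakk>p \<in> carrier (free_alg m n); w \<in> Poly_Mapping.keys p\<rbrakk> \<Longrightarrow> set (letters w) \<subseteq> gens m n"
  by (simp add: free_alg_def)

lemma free_alg_closed:
  fixes x y :: "'f::field_char_0 free"
  assumes "x \<in> carrier (free_alg m n)" "y \<in> carrier (free_alg m n)"
  shows "x + y \<in> carrier (free_alg m n)" "- x \<in> carrier (free_alg m n)"
    "x - y \<in> carrier (free_alg m n)" "x * y \<in> carrier (free_alg m n)"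
proof -
  show add: "x + y \<in> carrier (free_alg m n)"
    using assms keys_add[of x y] by (intro free_alg_memI) (blast dest: free_alg_memD)
  show "- x \<in> carrier (free_alg m n)"
    using assms by (auto simp: free_alg_def)
  show "x - y \<in> carrier (free_alg m n)"
    using assms keys_diff[of x y] by (intro free_alg_memI) (blast dest: free_alg_memD)
  show "x * y \<in> carrier (free_alg m n)"
  proof (rule free_alg_memI)
    fix w assume "w \<in> Poly_Mapping.keys (x * y)"
    then obtain a b where "w = a + b" "a \<in> Poly_Mapping.keys x" "b \<in> Poly_Mapping.keys y"
      using keys_mult[of x y] by blast
    then show "set (letters w) \<subseteq> gens m n"
      using assms by (auto simp: plus_word_def dest: free_alg_memD)
  qed
qed

lemma free_alg_scalar: "scalar a \<in> carrier (free_alg m n)"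
  by (rule free_alg_memI) (simp add: scalar_def zero_word_def split: if_splits)

lemma free_alg_0: "0 \<in> carrier (free_alg m n)"
  by (simp add: free_alg_def)

lemma free_alg_1: "1 \<in> carrier (free_alg m n)"
  by (rule free_alg_memI) (simp add: zero_word_def)

lemma free_alg_var: "g \<in> gens m n \<Longrightarrow> var g \<in> carrier (free_alg m n)"
  by (rule free_alg_memI) (simp add: var_def)

lemmas free_alg_intros =
  free_alg_closed free_alg_scalar free_alg_0 free_alg_1 free_alg_var

lemma ring_free_alg: "ring (free_alg m n :: 'f::field_char_0 free ring)"
proof (rule ringI)
  show "abelian_group (free_alg m n :: 'f free ring)"
  proof (rule abelian_groupI)
    fix x :: "'f free" assume "x \<in> carrier (free_alg m n)"
    then show "\<exists>y\<in>carrier (free_alg m n). y \<oplus>\<^bsub>free_alg m n\<^esub> x = \<zero>\<^bsub>free_alg m n\<^esub>"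
      by (intro bexI[of _ "- x"]) (simp_all add: free_alg_closed)
  qed (simp_all add: free_alg_closed free_alg_0 ac_simps)
  show "monoid (free_alg m n :: 'f free ring)"
    by (rule monoidI) (simp_all add: free_alg_closed free_alg_1 mult.assoc)
qed (simp_all add: distrib_left distrib_right)

lemma root_E_closed:
  "\<lbrakk>1 \<le> i; i < j; j \<le> m + n\<rbrakk> \<Longrightarrow> root_E k i j \<in> carrier (free_alg m n)"
proof (induction k i j rule: root_E.induct)
  case (1 k i j)
  show ?case
  proof (cases "j \<le> i + 1")
    case True
    with 1 show ?thesis by (subst root_E.simps) (auto intro!: free_alg_var simp: gens_def)
  next
    case False
    with 1 show ?thesis
      by (subst root_E.simps) (auto intro!: free_alg_closed free_alg_scalar simp: Let_def)
  qed
qed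

lemma root_F_closed:
  "\<lbrakk>1 \<le> i; i < j; j \<le> m + n\<rbrakk> \<Longrightarrow> root_F k i j \<in> carrier (free_alg m n)"
proof (induction k i j rule: root_F.induct)
  case (1 k i j)
  show ?case
  proof (cases "j \<le> i + 1")
    case True
    with 1 show ?thesis by (subst root_F.simps) (auto intro!: free_alg_var simp: gens_def)
  next
    case False
    with 1 show ?thesis
      by (subst root_F.simps) (auto intro!: free_alg_closed free_alg_scalar simp: Let_def)
  qed
qed

lemma free_alg_gen:
  "1 \<le> i \<Longrightarrow> i < m + n \<Longrightarrow> var (GE i) \<in> carrier (free_alg m n)"
  "1 \<le> i \<Longrightarrow> i < m + n \<Longrightarrow> var (GF i) \<in> carrier (free_alg m n)"
  "1 \<le> i \<Longrightarrow> i \<le> m + n \<Longrightarrow> var (GK i) \<in> carrier (free_alg m n)"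
  "1 \<le> i \<Longrightarrow> i \<le> m + n \<Longrightarrow> var (GKi i) \<in> carrier (free_alg m n)"
  by (auto intro!: free_alg_var simp: gens_def)

lemma scomm_closed:
  fixes x y :: "'f::field_char_0 free"
  assumes "x \<in> carrier (free_alg m n)" "y \<in> carrier (free_alg m n)"
  shows "scomm a b x y \<in> carrier (free_alg m n)"
  unfolding scomm_def using assms by (simp add: free_alg_closed)

lemma serre_closed:
  assumes "x \<in> carrier (free_alg m n)" "y \<in> carrier (free_alg m n)"
  shows "serre x y \<in> carrier (free_alg m n)"
  unfolding serre_def using assms by (intro free_alg_closed free_alg_scalar)

lemma cartan_closed:
  assumes "1 \<le> i" "i < m + n"
  shows "cartan k i \<in> carrier (free_alg m n)"
  unfolding cartan_def using assms
  by (intro free_alg_closed free_alg_scalar free_alg_gen) simp_all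

lemma rels_closed:
  fixes m n :: nat
  assumes "1 \<le> m" "1 \<le> n"
  shows "rels m n \<subseteq> carrier (free_alg m n :: 'f::field_char_0 free ring)"
proof -
  let ?C = "carrier (free_alg m n :: 'f free ring)"
  note closed = free_alg_closed free_alg_scalar free_alg_0 free_alg_1 free_alg_gen
  have "rels_K m n \<subseteq> ?C"
    unfolding rels_K_def by (clarsimp simp del: One_nat_def) (safe; intro closed; simp)
  moreover have "rels_KEF m n \<subseteq> ?C"
    unfolding rels_KEF_def by (clarsimp simp del: One_nat_def) (safe; intro closed; simp)
  moreover have "rels_EF m n \<subseteq> ?C"
    unfolding rels_EF_def
    by (auto simp del: gen_parity.simps
        intro!: free_alg_closed(3) scomm_closed cartan_closed free_alg_gen free_alg_0)
  moreover have "rels_odd m \<subseteq> ?C"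
    unfolding rels_odd_def using assms by (simp add: free_alg_closed free_alg_gen)
  moreover have "rels_far m n \<subseteq> ?C"
    unfolding rels_far_def by (auto intro!: free_alg_closed(3,4) free_alg_gen)
  moreover have "rels_serre m n \<subseteq> ?C"
    unfolding rels_serre_def by (auto intro!: serre_closed free_alg_gen)
  moreover have "rels_super m n \<subseteq> ?C"
    unfolding rels_super_def using assms
    by (auto intro!: scomm_closed root_E_closed root_F_closed free_alg_gen)
  ultimately show ?thesis
    unfolding rels_def by blast
qed

lemma ring_Uq:
  assumes "1 \<le> m" "1 \<le> n"
  shows "ring (Uq m n :: 'f::field_char_0 uq ring)"
  unfolding Uq_def uq_ideal_def
  by (rule ideal.quotient_is_ring, rule ring.genideal_ideal[OF ring_free_alg rels_closed[OF assms]])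

end

theory Submission
  imports Defs
begin

text \<open>
  Everything is governed by one functional \<open>eps\<close> on the free algebra, the Harish-Chandra projection
  evaluated at \<open>c\<close>: it kills the left multiples of the $E_{i,i+1}$ and the right multiples of the
  $F_{i,i+1}$, and sends $K_i$ to $c_i$. The algebra given by the first three families of relations
  acts on words in the letters $F_{j,j+1}$ by prepending a letter and moving each $E_{i,i+1}$ past
  the letters, and \<open>eps z\<close> is the coefficient of the empty word in \<open>z\<close> applied to the empty word.
  The $E$-halves of the remaining relations act by zero, because applied to a word they commute up
  to sign with the letters and kill the empty word. Reading words backwards with $E$ and $F$
  interchanged gives a second functional, which agrees with \<open>eps\<close> since both vanish on the
  same left ideal and any element reduces to a combination of words in the $F_{j,j+1}$ modulo it;
  it disposes of the $F$-halves.

  Let \<open>P\<close> consist of all \<open>x\<close> with \<open>eps (y * x) = 0\<close> for all \<open>y\<close>. Since \<open>q\<close> is not a root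
  of unity, the weights of nonempty words differ from \<open>c\<close>, so a left ideal \<open>Q\<close> containing the
  annihilator relations of a vector of weight \<open>c\<close> contains \<open>eps z\<close> for each \<open>z\<close> in \<open>Q\<close>; hence
  \<open>P\<close> is the largest proper one. The simple module is the free algebra modulo \<open>P\<close>, and a
  maximal vector in it is determined by its value under \<open>eps\<close>.
\<close>

section \<open>Linear functionals and operator representations of free algebras\<close>

definition lin_ext :: "('a \<Rightarrow> 'k) \<Rightarrow> ('a \<Rightarrow>\<^sub>0 'k) \<Rightarrow> 'k::comm_ring_1" where
  "lin_ext \<phi> p = (\<Sum>w\<in>Poly_Mapping.keys p. Poly_Mapping.lookup p w * \<phi> w)"

lemma lin_ext_superset:
  "finite S \<Longrightarrow> Poly_Mapping.keys p \<subseteq> S \<Longrightarrow> lin_ext \<phi> p = (\<Sum>w\<in>S. Poly_Mapping.lookup p w * \<phi> w)"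
  unfolding lin_ext_def by (rule sum.mono_neutral_left) (auto simp: in_keys_iff)

lemma lin_ext_zero [simp]: "lin_ext \<phi> 0 = 0"
  by (simp add: lin_ext_def)

lemma lin_ext_single [simp]: "lin_ext \<phi> (Poly_Mapping.single w a) = a * \<phi> w"
  by (subst lin_ext_superset[of "{w}"]) auto

lemma lin_ext_add [simp]: "lin_ext \<phi> (p + q) = lin_ext \<phi> p + lin_ext \<phi> q"
proof -
  let ?S = "Poly_Mapping.keys p \<union> Poly_Mapping.keys q"
  have "lin_ext \<phi> (p + q) = (\<Sum>w\<in>?S. Poly_Mapping.lookup (p + q) w * \<phi> w)"
    using keys_add[of p q] by (intro lin_ext_superset) auto
  then show ?thesis
    by (subst (1 2) lin_ext_superset[of ?S]) (auto simp: lookup_add distrib_right sum.distrib)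
qed

lemma lin_ext_uminus [simp]: "lin_ext \<phi> (- p) = - lin_ext \<phi> p"
  using lin_ext_add[of \<phi> "- p" p] by (simp add: eq_neg_iff_add_eq_0)

lemma lin_ext_diff [simp]: "lin_ext \<phi> (p - q) = lin_ext \<phi> p - lin_ext \<phi> q"
  using lin_ext_add[of \<phi> p "- q"] by simp

text \<open>Induction on the number of support points, removing the term at one key. It reduces
  linear identities to monomials; the step has to cover every \<open>w\<close>, including one
  already in the support.\<close>

lemma poly_mapping_linear_induct [case_names zero add]:
  assumes "P 0" and "\<And>p w a. P p \<Longrightarrow> P (p + Poly_Mapping.single w a)"
  shows "P (p :: 'a \<Rightarrow>\<^sub>0 'b::ab_group_add)"
proof (induction "card (Poly_Mapping.keys p)" arbitrary: p rule: less_induct)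
  case less
  show ?case
  proof (cases "Poly_Mapping.keys p = {}")
    case True
    then show ?thesis using assms(1) by simp
  next
    case False
    then obtain w where w: "w \<in> Poly_Mapping.keys p" by blast
    let ?q = "p - Poly_Mapping.single w (Poly_Mapping.lookup p w)"
    have "Poly_Mapping.keys ?q \<subseteq> Poly_Mapping.keys p - {w}"
      using w by (auto simp: in_keys_iff lookup_minus lookup_single when_def split: if_splits)
    with w have "card (Poly_Mapping.keys ?q) < card (Poly_Mapping.keys p)"
      by (intro psubset_card_mono) auto
    then have "P ?q" by (rule less)
    then have "P (?q + Poly_Mapping.single w (Poly_Mapping.lookup p w))" by (rule assms(2))
    then show ?thesis by simp
  qed
qed

lemma lin_ext_phi_add: "lin_ext (\<lambda>w. \<phi> w + \<psi> w) p = lin_ext \<phi> p + lin_ext \<psi> p"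
  by (simp add: lin_ext_def distrib_left sum.distrib)

lemma lin_ext_phi_scale: "lin_ext (\<lambda>w. a * \<phi> w) p = a * lin_ext \<phi> p"
  by (simp add: lin_ext_def sum_distrib_left ac_simps)

lemma lin_ext_single_mult: "lin_ext \<phi> (Poly_Mapping.single v a * p) = a * lin_ext (\<lambda>w. \<phi> (v + w)) p"
  by (induction p rule: poly_mapping_linear_induct) (simp_all add: distrib_left mult_single mult.assoc)

lemma lin_ext_mult_single: "lin_ext \<phi> (p * Poly_Mapping.single v a) = a * lin_ext (\<lambda>w. \<phi> (w + v)) p"
  by (induction p rule: poly_mapping_linear_induct)
    (simp_all add: distrib_left distrib_right mult_single ac_simps)

definition linear_op :: "(('x \<Rightarrow> 'k::comm_ring_1) \<Rightarrow> ('x \<Rightarrow> 'k)) \<Rightarrow> bool" where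
  "linear_op T \<longleftrightarrow> (\<forall>f g. T (\<lambda>u. f u + g u) = (\<lambda>u. T f u + T g u)) \<and>
     (\<forall>a f. T (\<lambda>u. a * f u) = (\<lambda>u. a * T f u))"

lemma linear_op_add: "linear_op T \<Longrightarrow> T (\<lambda>u. f u + g u) = (\<lambda>u. T f u + T g u)"
  and linear_op_scale: "linear_op T \<Longrightarrow> T (\<lambda>u. a * f u) = (\<lambda>u. a * T f u)"
  by (simp_all add: linear_op_def)

lemma linear_op_zero: "linear_op T \<Longrightarrow> T (\<lambda>u. 0) = (\<lambda>u. 0)"
  using linear_op_scale[of T 0 "\<lambda>u. 0"] by simp

lemma linear_op_foldr:
  assumes "\<And>g. linear_op (op g)"
  shows "linear_op (foldr op gs)"
proof (induction gs)
  case (Cons g gs)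
  with assms[of g] show ?case by (simp add: linear_op_def)
qed (simp add: linear_op_def)

text \<open>Two ways to extend operators from generators to the free algebra:
  \<open>left_act\<close> is an algebra homomorphism, \<open>right_act\<close> an anti-homomorphism,
  as suits transposed operators.\<close>

definition left_act :: "('g \<Rightarrow> ('x \<Rightarrow> 'k) \<Rightarrow> ('x \<Rightarrow> 'k)) \<Rightarrow> ('g word \<Rightarrow>\<^sub>0 'k) \<Rightarrow> ('x \<Rightarrow> 'k) \<Rightarrow> 'x \<Rightarrow> 'k::comm_ring_1" where
  "left_act op p f = (\<lambda>u. lin_ext (\<lambda>w. foldr op (letters w) f u) p)"

definition right_act :: "('g \<Rightarrow> ('x \<Rightarrow> 'k) \<Rightarrow> ('x \<Rightarrow> 'k)) \<Rightarrow> ('g word \<Rightarrow>\<^sub>0 'k) \<Rightarrow> ('x \<Rightarrow> 'k) \<Rightarrow> 'x \<Rightarrow> 'k::comm_ring_1" where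
  "right_act op p f = (\<lambda>u. lin_ext (\<lambda>w. foldr op (rev (letters w)) f u) p)"

lemma left_act_add [simp]: "left_act op (p + q) f = (\<lambda>u. left_act op p f u + left_act op q f u)"
  and left_act_diff [simp]: "left_act op (p - q) f = (\<lambda>u. left_act op p f u - left_act op q f u)"
  and left_act_uminus [simp]: "left_act op (- p) f = (\<lambda>u. - left_act op p f u)"
  and left_act_0 [simp]: "left_act op 0 f = (\<lambda>u. 0)"
  and left_act_scalar [simp]: "left_act op (scalar a) f = (\<lambda>u. a * f u)"
  and left_act_1 [simp]: "left_act op 1 f = f"
  and left_act_var [simp]: "left_act op (var g) f = op g f"
  by (simp_all add: left_act_def scalar_def var_def zero_word_def flip: single_one)

lemma right_act_add [simp]: "right_act op (p + q) f = (\<lambda>u. right_act op p f u + right_act op q f u)"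
  and right_act_diff [simp]: "right_act op (p - q) f = (\<lambda>u. right_act op p f u - right_act op q f u)"
  and right_act_uminus [simp]: "right_act op (- p) f = (\<lambda>u. - right_act op p f u)"
  and right_act_0 [simp]: "right_act op 0 f = (\<lambda>u. 0)"
  and right_act_scalar [simp]: "right_act op (scalar a) f = (\<lambda>u. a * f u)"
  and right_act_1 [simp]: "right_act op 1 f = f"
  and right_act_var [simp]: "right_act op (var g) f = op g f"
  by (simp_all add: right_act_def scalar_def var_def zero_word_def flip: single_one)

lemma left_act_linear: assumes "\<And>g. linear_op (op g)" shows "linear_op (left_act op p)"
  unfolding linear_op_def left_act_def
  by (simp add: linear_op_add[OF linear_op_foldr, OF assms]
      linear_op_scale[OF linear_op_foldr, OF assms] lin_ext_phi_add lin_ext_phi_scale)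

lemma right_act_linear: assumes "\<And>g. linear_op (op g)" shows "linear_op (right_act op p)"
  unfolding linear_op_def right_act_def
  by (simp add: linear_op_add[OF linear_op_foldr, OF assms]
      linear_op_scale[OF linear_op_foldr, OF assms] lin_ext_phi_add lin_ext_phi_scale)

text \<open>The right factor acts on \<open>f\<close> first, so the induction runs over
  \<open>q\<close>; in \<open>right_act_mult\<close> the left factor acts first and it runs over
  \<open>p\<close>.\<close>

lemma left_act_mult:
  assumes "\<And>g. linear_op (op g)"
  shows "left_act op (p * q) f = left_act op p (left_act op q f)"
proof (induction q rule: poly_mapping_linear_induct)
  case zero
  then show ?case by (simp add: linear_op_zero[OF left_act_linear, OF assms])
next
  case (add q w a)
  have "left_act op (p * Poly_Mapping.single w a) f = left_act op p (left_act op (Poly_Mapping.single w a) f)"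
    by (simp add: left_act_def lin_ext_mult_single plus_word_def)
      (simp add: linear_op_scale[OF linear_op_foldr, OF assms] lin_ext_phi_scale)
  with add show ?case
    by (simp add: distrib_left linear_op_add[OF left_act_linear, OF assms])
qed

lemma right_act_mult:
  assumes "\<And>g. linear_op (op g)"
  shows "right_act op (p * q) f = right_act op q (right_act op p f)"
proof (induction p rule: poly_mapping_linear_induct)
  case zero
  then show ?case by (simp add: linear_op_zero[OF right_act_linear, OF assms])
next
  case (add p w a)
  have "right_act op (Poly_Mapping.single w a * q) f = right_act op q (right_act op (Poly_Mapping.single w a) f)"
    by (simp add: right_act_def lin_ext_single_mult plus_word_def)
      (simp add: linear_op_scale[OF linear_op_foldr, OF assms] lin_ext_phi_scale)
  with add show ?case
    by (simp add: distrib_right linear_op_add[OF right_act_linear, OF assms])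
qed

section \<open>Operators on functions of words\<close>

lemma qq_power: "(qq :: 'f::field_char_0 ratfun) ^ n = Fraction_Field.Fract (Polynomial.monom 1 n) 1"
proof (induction n)
  case 0
  then show ?case by (simp add: One_fract_def)
next
  case (Suc n)
  then show ?case by (simp add: qq_def monom_Suc)
qed

lemma qq_nonzero [simp]: "(qq :: 'f::field_char_0 ratfun) \<noteq> 0"
  by (simp add: qq_def Zero_fract_def eq_fract)

lemma qq_power_neq_1: "0 < n \<Longrightarrow> (qq :: 'f::field_char_0 ratfun) ^ n \<noteq> 1"
  by (simp add: qq_power One_fract_def eq_fract monom_eq_1_iff)

lemma qi_nonzero [simp]: "qi m i \<noteq> 0"
  by (simp add: qi_def)

text \<open>Inverting if necessary makes the exponent nonnegative, and then the equation is one
  between polynomials in the indeterminate. The base \<open>qi m i\<close> is \<open>qq\<close> or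
  its inverse.\<close>

lemma qi_powi_eq_1: "(qi m i :: 'f::field_char_0 ratfun) powi a = 1 \<Longrightarrow> a = 0"
proof -
  have *: "a = 0" if "(qq :: 'f::field_char_0 ratfun) powi a = 1" for a
  proof (rule ccontr)
    assume "a \<noteq> 0"
    moreover have "qq ^ nat \<bar>a\<bar> = (1 :: 'f ratfun)"
      using that by (cases "a \<ge> 0") (auto simp: power_int_def power_inverse)
    ultimately show False
      using qq_power_neq_1[where 'f = 'f, of "nat \<bar>a\<bar>"] by simp
  qed
  assume "(qi m i :: 'f ratfun) powi a = 1"
  then show ?thesis
    using *[of a] *[of "- a"] by (auto simp: qi_def power_int_minus power_int_inverse split: if_splits)
qed

text \<open>A word \<open>w\<close> stands for the product of the $F_{j,j+1}$ with \<open>j\<close> in \<open>w\<close>, applied to a vector of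
  weight \<open>c\<close>, and operators act on functions of words by transposition; thus products of
  generators act in reverse order and no finite support has to be tracked.\<close>

definition K_weight :: "nat \<Rightarrow> (nat \<Rightarrow> 'f::field_char_0 ratfun) \<Rightarrow> nat \<Rightarrow> nat list \<Rightarrow> 'f ratfun" where
  "K_weight m c i w = c i * qi m i powi (- (\<Sum>j\<leftarrow>w. wt i j))"

lemma K_weight_Nil [simp]: "K_weight m c i [] = c i"
  by (simp add: K_weight_def)

lemma K_weight_Cons: "K_weight m c i (j # w) = qi m i powi (- wt i j) * K_weight m c i w"
  by (simp add: K_weight_def power_int_add power_int_diff power_int_minus field_simps)

lemma K_weight_nonzero: "c i \<noteq> 0 \<Longrightarrow> K_weight m c i w \<noteq> 0"
  by (simp add: K_weight_def)

definition K_op :: "nat \<Rightarrow> (nat \<Rightarrow> 'f::field_char_0 ratfun) \<Rightarrow> nat \<Rightarrow> (nat list \<Rightarrow> 'f ratfun) \<Rightarrow> nat list \<Rightarrow> 'f ratfun" where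
  "K_op m c i f = (\<lambda>w. K_weight m c i w * f w)"

definition Ki_op :: "nat \<Rightarrow> (nat \<Rightarrow> 'f::field_char_0 ratfun) \<Rightarrow> nat \<Rightarrow> (nat list \<Rightarrow> 'f ratfun) \<Rightarrow> nat list \<Rightarrow> 'f ratfun" where
  "Ki_op m c i f = (\<lambda>w. inverse (K_weight m c i w) * f w)"

definition F_op :: "nat \<Rightarrow> (nat list \<Rightarrow> 'f::field_char_0 ratfun) \<Rightarrow> nat list \<Rightarrow> 'f ratfun" where
  "F_op j f = (\<lambda>w. f (j # w))"

definition cartan_op :: "nat \<Rightarrow> (nat \<Rightarrow> 'f::field_char_0 ratfun) \<Rightarrow> nat \<Rightarrow> (nat list \<Rightarrow> 'f ratfun) \<Rightarrow> nat list \<Rightarrow> 'f ratfun" where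
  "cartan_op m c i f = (\<lambda>w. inverse (qi m i - inverse (qi m i)) *
     (K_op m c i (Ki_op m c (i+1) f) w - Ki_op m c i (K_op m c (i+1) f) w))"

text \<open>Transpose of a raising generator: it is moved past the leading letter by the relation in
  \<open>rels_EF\<close>, with a sign when both are odd, and kills the empty word, which stands for
  the highest weight vector. The word precedes \<open>f\<close> because the recursion is on the word
  while \<open>f\<close> changes to \<open>F_op j f\<close>.\<close>

primrec E_word :: "nat \<Rightarrow> (nat \<Rightarrow> 'f::field_char_0 ratfun) \<Rightarrow> nat \<Rightarrow> nat list \<Rightarrow> (nat list \<Rightarrow> 'f ratfun) \<Rightarrow> 'f ratfun" where
  "E_word m c i [] f = 0"
| "E_word m c i (j # w) f = (if i = m \<and> j = m then - 1 else 1) * E_word m c i w (F_op j f)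
     + (if i = j then cartan_op m c i f w else 0)"

definition E_op :: "nat \<Rightarrow> (nat \<Rightarrow> 'f::field_char_0 ratfun) \<Rightarrow> nat \<Rightarrow> (nat list \<Rightarrow> 'f ratfun) \<Rightarrow> nat list \<Rightarrow> 'f ratfun" where
  "E_op m c i f = (\<lambda>w. E_word m c i w f)"

lemma E_op_Nil [simp]: "E_op m c i f [] = 0"
  by (simp add: E_op_def)

lemma E_op_Cons: "E_op m c i f (j # w) = (if i = m \<and> j = m then - 1 else 1) * E_op m c i (F_op j f) w
     + (if i = j then cartan_op m c i f w else 0)"
  by (simp add: E_op_def)

text \<open>The recursion of \<open>E_word\<close> as an identity of operators, so that it can be
  used below further operators. It is the transpose of \<open>rels_EF\<close>, hence the reversed
  order of the factors.\<close>

lemma F_op_E_op: "F_op j (E_op m c i f) = (\<lambda>w. (if i = m \<and> j = m then - 1 else 1) * E_op m c i (F_op j f) w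
     + (if i = j then cartan_op m c i f w else 0))"
  by (simp add: F_op_def[of j "E_op m c i f"] E_op_Cons)

lemma linear_F_op: "linear_op (F_op j)"
  by (simp add: linear_op_def F_op_def)
lemma linear_K_op: "linear_op (K_op m c j)"
  by (simp add: linear_op_def K_op_def algebra_simps)
lemma linear_Ki_op: "linear_op (Ki_op m c j)"
  by (simp add: linear_op_def Ki_op_def algebra_simps)
lemma linear_cartan_op: "linear_op (cartan_op m c j)"
  by (simp add: linear_op_def cartan_op_def K_op_def Ki_op_def algebra_simps)
lemma linear_E_op: "linear_op (E_op m c j)"
proof -
  have "E_op m c j (\<lambda>u. f u + g u) w = E_op m c j f w + E_op m c j g w" for f g w
    by (induction w arbitrary: f g)
      (simp_all add: E_op_Cons linear_op_add[OF linear_F_op] linear_op_add[OF linear_cartan_op])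
  moreover have "E_op m c j (\<lambda>u. a * f u) w = a * E_op m c j f w" for f a w
    by (induction w arbitrary: f)
      (simp_all add: E_op_Cons linear_op_scale[OF linear_F_op] linear_op_scale[OF linear_cartan_op] algebra_simps)
  ultimately show ?thesis by (simp add: linear_op_def fun_eq_iff)
qed

lemma linear_op_minus: "linear_op T \<Longrightarrow> T (\<lambda>u. - f u) = (\<lambda>u. - T f u)"
  using linear_op_scale[of T "- 1" f] by simp

lemma linear_op_diff: "linear_op T \<Longrightarrow> T (\<lambda>u. f u - g u) = (\<lambda>u. T f u - T g u)"
  using linear_op_add[of T f "\<lambda>u. - g u"] linear_op_minus[of T g] by simp

lemmas op_linears = linear_E_op linear_F_op linear_K_op linear_Ki_op linear_cartan_op
lemmas op_linear_simps = op_linears[THEN linear_op_add] op_linears[THEN linear_op_diff]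
  op_linears[THEN linear_op_scale] op_linears[THEN linear_op_minus] op_linears[THEN linear_op_zero]

lemma F_op_K_op: "F_op j (K_op m c i f) = (\<lambda>w. qi m i powi (- wt i j) * K_op m c i (F_op j f) w)"
  by (simp add: F_op_def K_op_def K_weight_Cons algebra_simps)

lemma F_op_Ki_op: "F_op j (Ki_op m c i f) = (\<lambda>w. qi m i powi wt i j * Ki_op m c i (F_op j f) w)"
  by (simp add: F_op_def Ki_op_def K_weight_Cons power_int_minus algebra_simps)

lemma K_op_comm: "K_op m c i (K_op m c j f) = K_op m c j (K_op m c i f)"
  "Ki_op m c i (Ki_op m c j f) = Ki_op m c j (Ki_op m c i f)"
  "Ki_op m c i (K_op m c j f) = K_op m c j (Ki_op m c i f)"
  by (simp_all add: K_op_def Ki_op_def algebra_simps)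

lemma cartan_op_K_op: "cartan_op m c i (K_op m c j f) = K_op m c j (cartan_op m c i f)"
   "cartan_op m c i (Ki_op m c j f) = Ki_op m c j (cartan_op m c i f)"
  by (simp_all add: cartan_op_def K_op_def Ki_op_def algebra_simps)

text \<open>Transpose of \<open>rels_KEF\<close>. The function varies in the induction, since
  peeling off a letter \<open>l\<close> replaces \<open>f\<close> by \<open>F_op l f\<close>; the
  later inductions on words have the same shape.\<close>

lemma E_op_K_op: "E_op m c j (K_op m c i f) = (\<lambda>w. qi m i powi wt i j * K_op m c i (E_op m c j f) w)"
proof
  fix w
  show "E_op m c j (K_op m c i f) w = qi m i powi wt i j * K_op m c i (E_op m c j f) w"
  proof (induction w arbitrary: f)
    case Nil
    then show ?case by (simp add: K_op_def)
  next
    case (Cons l w)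
    then show ?case
      by (simp add: E_op_Cons F_op_K_op op_linear_simps cartan_op_K_op power_int_minus)
        (simp add: K_op_def E_op_Cons K_weight_Cons power_int_minus field_simps)
  qed
qed

lemma E_op_Ki_op: "E_op m c j (Ki_op m c i f) = (\<lambda>w. qi m i powi (- wt i j) * Ki_op m c i (E_op m c j f) w)"
proof
  fix w
  show "E_op m c j (Ki_op m c i f) w = qi m i powi (- wt i j) * Ki_op m c i (E_op m c j f) w"
  proof (induction w arbitrary: f)
    case Nil
    then show ?case by (simp add: Ki_op_def)
  next
    case (Cons l w)
    then show ?case
      \<comment> \<open>Nothing is assumed about \<open>c\<close> here, so \<open>K_weight\<close>
        may vanish; its inverse is then 0 and the case is treated separately.\<close>
      by (simp add: E_op_Cons F_op_Ki_op op_linear_simps cartan_op_K_op power_int_minus)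
        (cases "K_weight m c i w = 0"; simp add: Ki_op_def E_op_Cons K_weight_Cons power_int_minus field_simps)
  qed
qed

text \<open>\<open>A_op\<close> and \<open>B_op\<close> are the two halves of the Cartan term,
  transposes of \<open>K_i K_{i+1}^{-1}\<close> and its inverse. Each commutes with every
  \<open>E_op\<close> up to a scalar.\<close>

definition A_op :: "nat \<Rightarrow> (nat \<Rightarrow> 'f::field_char_0 ratfun) \<Rightarrow> nat \<Rightarrow> (nat list \<Rightarrow> 'f ratfun) \<Rightarrow> nat list \<Rightarrow> 'f ratfun" where
  "A_op m c i f = K_op m c i (Ki_op m c (i+1) f)"

definition B_op :: "nat \<Rightarrow> (nat \<Rightarrow> 'f::field_char_0 ratfun) \<Rightarrow> nat \<Rightarrow> (nat list \<Rightarrow> 'f ratfun) \<Rightarrow> nat list \<Rightarrow> 'f ratfun" where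
  "B_op m c i f = Ki_op m c i (K_op m c (i+1) f)"

text \<open>This is \<open>qq\<close> raised to the inner product of the simple roots
  \<open>i\<close> and \<open>j\<close> of gl(m,n).\<close>

definition exchange :: "nat \<Rightarrow> nat \<Rightarrow> nat \<Rightarrow> 'f::field_char_0 ratfun" where
  "exchange m i j = qi m i powi wt i j * qi m (i+1) powi (- wt (i+1) j)"

lemma E_op_A_op: "E_op m c j (A_op m c i f) = (\<lambda>w. exchange m i j * A_op m c i (E_op m c j f) w)"
  by (simp add: A_op_def E_op_K_op E_op_Ki_op op_linear_simps exchange_def power_int_minus mult.assoc)

lemma E_op_B_op: "E_op m c j (B_op m c i f) = (\<lambda>w. inverse (exchange m i j) * B_op m c i (E_op m c j f) w)"
  by (simp add: B_op_def E_op_K_op E_op_Ki_op op_linear_simps exchange_def power_int_minus mult.assoc)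

lemma cartan_op_eq: "cartan_op m c i f = (\<lambda>w. inverse (qi m i - inverse (qi m i)) * (A_op m c i f w - B_op m c i f w))"
  by (simp add: cartan_op_def A_op_def B_op_def)

lemma linear_A_op: "linear_op (A_op m c j)"
  by (simp add: linear_op_def A_op_def op_linear_simps)
lemma linear_B_op: "linear_op (B_op m c j)"
  by (simp add: linear_op_def B_op_def op_linear_simps)

lemmas op_linear_simps' = op_linear_simps linear_A_op[THEN linear_op_add] linear_A_op[THEN linear_op_diff]
  linear_A_op[THEN linear_op_scale] linear_A_op[THEN linear_op_minus] linear_A_op[THEN linear_op_zero]
  linear_B_op[THEN linear_op_add] linear_B_op[THEN linear_op_diff]
  linear_B_op[THEN linear_op_scale] linear_B_op[THEN linear_op_minus] linear_B_op[THEN linear_op_zero]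

lemma exchange_same_odd: "exchange m m m = 1"
  by (simp add: exchange_def wt_def qi_def power_int_minus)
lemma exchange_same: "i \<noteq> m \<Longrightarrow> exchange m i i = qi m i ^ 2"
  by (simp add: exchange_def wt_def qi_def power_int_minus power2_eq_square)
lemma exchange_up: "exchange m i (Suc i) = inverse (qi m (i+1))"
  by (simp add: exchange_def wt_def power_int_minus)
lemma exchange_down: "exchange m (Suc i) i = inverse (qi m (i+1))"
  by (simp add: exchange_def wt_def power_int_minus)
lemma exchange_far: "i \<noteq> j \<Longrightarrow> i \<noteq> Suc j \<Longrightarrow> j \<noteq> Suc i \<Longrightarrow> exchange m i j = 1"
  by (simp add: exchange_def wt_def)

section \<open>The operators satisfy the relations among the raising generators\<close>

text \<open>Past a letter \<open>m\<close> the square produces two Cartan terms of opposite sign.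
  They cancel because the odd root is isotropic, that is, \<open>exchange m m m = 1\<close>.\<close>

lemma E_op_odd: "E_op m c m (E_op m c m f) = (\<lambda>w. 0)"
proof
  fix w show "E_op m c m (E_op m c m f) w = 0"
  proof (induction w arbitrary: f)
    case (Cons l w)
    then show ?case
      by (simp add: E_op_Cons F_op_E_op op_linear_simps' cartan_op_eq E_op_A_op E_op_B_op exchange_same_odd)
  qed simp
qed

text \<open>Orthogonal roots have \<open>exchange\<close> equal to 1, so a Cartan term coming from
  one operator commutes with the other.\<close>

lemma E_op_far:
  assumes "i \<noteq> j" "i \<noteq> Suc j" "j \<noteq> Suc i"
  shows "E_op m c i (E_op m c j f) = E_op m c j (E_op m c i f)"
proof
  fix w show "E_op m c i (E_op m c j f) w = E_op m c j (E_op m c i f) w"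
  proof (induction w arbitrary: f)
    case (Cons l w)
    then show ?case using assms
      by (auto simp add: E_op_Cons F_op_E_op op_linear_simps' cartan_op_eq E_op_A_op E_op_B_op exchange_far)
  qed simp
qed

lemma exchange_adjacent:
  assumes "j = Suc i \<or> i = Suc j"
  shows "exchange m i j = qq \<or> exchange m i j = inverse (qq :: 'f::field_char_0 ratfun)"
  using assms by (auto simp: exchange_up exchange_down qi_def)

text \<open>A letter \<open>l\<close> contributes the induction hypothesis for
  \<open>F_op l f\<close> and Cartan terms. Moving \<open>A_op\<close> and \<open>B_op\<close> to
  the front leaves scalar identities in \<open>qq\<close>, which say that the Cartan terms
  cancel.\<close>

lemma E_op_serre:
  fixes f :: "nat list \<Rightarrow> 'f::field_char_0 ratfun"
  assumes ij: "j = Suc i \<or> i = Suc j" and i: "i \<noteq> m"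
  shows "E_op m c i (E_op m c i (E_op m c j f)) w + E_op m c j (E_op m c i (E_op m c i f)) w
     = (qq + inverse qq) * E_op m c i (E_op m c j (E_op m c i f)) w"
proof (induction w arbitrary: f)
  case (Cons l w)
  \<comment> \<open>The Cartan terms are linear in this denominator, so it stays opaque. With
    \<open>r\<close> in place of the inverse of \<open>qq\<close> and the equation
    \<open>qq * r = 1\<close> the remaining goals are polynomial.\<close>
  define g where "g = (\<lambda>l. inverse (qi m l - inverse (qi m l)) :: 'f ratfun)"
  have cartan_op: "cartan_op m c l f = (\<lambda>w. g l * (A_op m c l f w - B_op m c l f w))" for l f
    by (simp add: g_def cartan_op_eq)
  define r where "r = inverse (qq :: 'f ratfun)"
  have r: "qq * r = 1" "inverse qq = r" "inverse r = qq" by (simp_all add: r_def)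
  have "i \<noteq> j" using ij by auto
  note IH = Cons[of "F_op l f", unfolded r(2)]
  consider "l = i" | "l = j" | "l \<noteq> i" "l \<noteq> j" by blast
  then show ?case
  proof cases
    case 1
    \<comment> \<open>Since \<open>i\<close> differs from \<open>m\<close>, both neighbours
      \<open>j\<close> have exchange scalar inverse to \<open>qi m i\<close>, and
      \<open>exchange m i i\<close> is its square.\<close>
    have "qi m i = (qq :: 'f ratfun) \<and> exchange m i j = r \<and> exchange m i i = (qq * qq :: 'f ratfun) \<or>
        qi m i = r \<and> exchange m i j = (qq :: 'f ratfun) \<and> exchange m i i = r * r"
      using ij i by (auto simp: exchange_up exchange_down exchange_same qi_def power2_eq_square r_def)
    then show ?thesis
    proof (elim disjE conjE)
      assume t: "exchange m i j = r" "exchange m i i = (qq * qq :: 'f ratfun)"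
      show ?thesis using IH[unfolded 1] unfolding 1 using \<open>i \<noteq> j\<close> i
        apply (simp add: E_op_Cons F_op_E_op op_linear_simps' cartan_op E_op_A_op E_op_B_op r(2,3) t)
        subgoal premises p using p(1) r(1) by Groebner_Basis.algebra
        done
    next
      assume t: "exchange m i j = (qq :: 'f ratfun)" "exchange m i i = r * r"
      show ?thesis using IH[unfolded 1] unfolding 1 using \<open>i \<noteq> j\<close> i
        apply (simp add: E_op_Cons F_op_E_op op_linear_simps' cartan_op E_op_A_op E_op_B_op r(2,3) t)
        subgoal premises p using p(1) r(1) by Groebner_Basis.algebra
        done
    qed
  next
    case 2
    \<comment> \<open>For the letter \<open>j\<close> the Cartan terms carry the factor
      \<open>t^2 - (qq + inverse qq) * t + 1\<close> with \<open>t = exchange m j i\<close> or its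
      inverse; its roots are \<open>qq\<close> and \<open>inverse qq\<close>.\<close>
    have "exchange m j i = (qq :: 'f ratfun) \<or> exchange m j i = r"
      unfolding r_def using ij by (intro exchange_adjacent) auto
    then show ?thesis
    proof (elim disjE)
      assume t: "exchange m j i = (qq :: 'f ratfun)"
      then have t': "j = m \<Longrightarrow> exchange m m i = (qq :: 'f ratfun)" by simp
      show ?thesis using IH[unfolded 2] unfolding 2 using \<open>i \<noteq> j\<close> i
        apply (cases "j = m"; simp add: E_op_Cons F_op_E_op op_linear_simps' cartan_op E_op_A_op E_op_B_op r(2,3) t t')
        subgoal premises p using p(1) r(1) by Groebner_Basis.algebra
        subgoal premises p using p(2) r(1) by Groebner_Basis.algebra
        done
    next
      assume t: "exchange m j i = r"
      then have t': "j = m \<Longrightarrow> exchange m m i = r" by simp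
      show ?thesis using IH[unfolded 2] unfolding 2 using \<open>i \<noteq> j\<close> i
        apply (cases "j = m"; simp add: E_op_Cons F_op_E_op op_linear_simps' cartan_op E_op_A_op E_op_B_op r(2,3) t t')
        subgoal premises p using p(1) r(1) by Groebner_Basis.algebra
        subgoal premises p using p(2) r(1) by Groebner_Basis.algebra
        done
    qed
  next
    case 3
    then show ?thesis using Cons[of "F_op l f"] i
      by (auto simp: E_op_Cons F_op_E_op op_linear_simps' cartan_op E_op_A_op E_op_B_op)
  qed
qed simp
text \<open>The supercommutator in \<open>rels_super\<close>, expanded with \<open>b\<close>
  squaring to zero and \<open>a\<close>, \<open>d\<close> commuting. With these two facts the
  identity is unchanged when all products are reversed, so it serves both representations.\<close>

lemma E_op_super:
  fixes f :: "nat list \<Rightarrow> 'f::field_char_0 ratfun" and m :: nat and c :: "nat \<Rightarrow> 'f ratfun"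
  defines "a \<equiv> E_op m c (m - 1)" and "b \<equiv> E_op m c m" and "d \<equiv> E_op m c (m + 1)"
  assumes m: "2 \<le> m"
  shows "a (b (d (b f))) w + d (b (a (b f))) w + b (a (b (d f))) w + b (d (b (a f))) w
     = (qq + inverse qq) * b (a (d (b f))) w"
proof (induction w arbitrary: f)
  case Nil
  show ?case by (simp add: a_def b_def d_def)
next
  case (Cons l w)
  define g where "g = (\<lambda>l. inverse (qi m l - inverse (qi m l)) :: 'f ratfun)"
  have cartan_op: "cartan_op m c l f = (\<lambda>w. g l * (A_op m c l f w - B_op m c l f w))" for l f
    by (simp add: g_def cartan_op_eq)
  define r where "r = inverse (qq :: 'f ratfun)"
  have r: "qq * r = 1" "inverse qq = r" "inverse r = qq" by (simp_all add: r_def)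
  obtain k where k: "m = Suc k" using m by (cases m) auto
  then have neq: "k \<noteq> m" "m \<noteq> k" "Suc m \<noteq> k" "k \<noteq> Suc m" by auto
  have bb: "b (b f) = (\<lambda>w. 0)" for f by (simp add: b_def E_op_odd)
  have ad: "d (a f) = a (d f)" for f unfolding a_def d_def by (rule E_op_far) (auto simp: k)
  have lin_ext: "linear_op a" "linear_op b" "linear_op d"
    by (simp_all add: a_def b_def d_def linear_E_op)
  note lins = lin_ext[THEN linear_op_add] lin_ext[THEN linear_op_diff] lin_ext[THEN linear_op_scale]
    lin_ext[THEN linear_op_minus] lin_ext[THEN linear_op_zero]
  \<comment> \<open>The simple roots \<open>k\<close>, \<open>m\<close>, \<open>Suc m\<close> have
    squared lengths 2, 0, -2; adjacent ones have inner products -1 and 1, the outer two are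
    orthogonal.\<close>
  have t: "exchange m k k = (qq * qq :: 'f ratfun)" "exchange m m m = (1 :: 'f ratfun)" "exchange m (Suc m) (Suc m) = r * r"
    "exchange m k m = r" "exchange m m k = r" "exchange m m (Suc m) = (qq :: 'f ratfun)"  "exchange m (Suc m) m = (qq :: 'f ratfun)"
    "exchange m k (Suc m) = (1 :: 'f ratfun)" "exchange m (Suc m) k = (1 :: 'f ratfun)"
    by (auto simp: k exchange_def wt_def qi_def r_def power_int_minus power2_eq_square)
  have D: "F_op l (a f) = (\<lambda>w. a (F_op l f) w + (if l = k then cartan_op m c k f w else 0))"
    "F_op l (d f) = (\<lambda>w. d (F_op l f) w + (if l = Suc m then cartan_op m c (Suc m) f w else 0))"
    "F_op l (b f) = (\<lambda>w. (if l = m then - 1 else 1) * b (F_op l f) w + (if l = m then cartan_op m c m f w else 0))"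
    "a f (l # w) = a (F_op l f) w + (if l = k then cartan_op m c k f w else 0)"
    "d f (l # w) = d (F_op l f) w + (if l = Suc m then cartan_op m c (Suc m) f w else 0)"
    "b f (l # w) = (if l = m then - 1 else 1) * b (F_op l f) w + (if l = m then cartan_op m c m f w else 0)" for l f w
    unfolding a_def b_def d_def by (auto simp: F_op_E_op E_op_Cons k fun_eq_iff)
  have AB: "a (A_op m c j f) = (\<lambda>w. exchange m j k * A_op m c j (a f) w)"
    "b (A_op m c j f) = (\<lambda>w. exchange m j m * A_op m c j (b f) w)"
    "d (A_op m c j f) = (\<lambda>w. exchange m j (Suc m) * A_op m c j (d f) w)"
    "a (B_op m c j f) = (\<lambda>w. inverse (exchange m j k) * B_op m c j (a f) w)"
    "b (B_op m c j f) = (\<lambda>w. inverse (exchange m j m) * B_op m c j (b f) w)"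
    "d (B_op m c j f) = (\<lambda>w. inverse (exchange m j (Suc m)) * B_op m c j (d f) w)" for j f
    unfolding a_def b_def d_def by (simp_all add: E_op_A_op E_op_B_op k)
  note IH = Cons[of "F_op l f", unfolded r(2)]
  note simps = D lins op_linear_simps' cartan_op AB t r(2,3) bb ad
  consider "l = k" | "l = m" | "l = Suc m" | "l \<noteq> k" "l \<noteq> m" "l \<noteq> Suc m" by blast
  then show ?case
  proof cases
    case 1
    show ?thesis unfolding 1 using IH[unfolded 1]
      apply (simp add: simps neq)
      subgoal premises p using p(1) r(1) by Groebner_Basis.algebra
      done
  next
    case 2
    show ?thesis unfolding 2 using IH[unfolded 2]
      apply (simp add: simps neq)
      subgoal premises p using p(1) r(1) by Groebner_Basis.algebra
      done
  next
    case 3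
    show ?thesis unfolding 3 using IH[unfolded 3]
      apply (simp add: simps neq)
      subgoal premises p using p(1) r(1) by Groebner_Basis.algebra
      done
  next
    case 4
    then show ?thesis using IH by (simp add: simps)
  qed
qed

section \<open>Two representations of the free algebra\<close>

text \<open>\<open>left_op\<close> interchanges $E$ and $F$. Together with the opposite order of multiplication
  this is the transposition anti-automorphism.\<close>

fun right_op :: "nat \<Rightarrow> (nat \<Rightarrow> 'f::field_char_0 ratfun) \<Rightarrow> gen \<Rightarrow> (nat list \<Rightarrow> 'f ratfun) \<Rightarrow> nat list \<Rightarrow> 'f ratfun" where
  "right_op m c (GE i) = E_op m c i"
| "right_op m c (GF i) = F_op i"
| "right_op m c (GK i) = K_op m c i"
| "right_op m c (GKi i) = Ki_op m c i"

fun left_op :: "nat \<Rightarrow> (nat \<Rightarrow> 'f::field_char_0 ratfun) \<Rightarrow> gen \<Rightarrow> (nat list \<Rightarrow> 'f ratfun) \<Rightarrow> nat list \<Rightarrow> 'f ratfun" where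
  "left_op m c (GE i) = F_op i"
| "left_op m c (GF i) = E_op m c i"
| "left_op m c (GK i) = K_op m c i"
| "left_op m c (GKi i) = Ki_op m c i"

lemma linear_right_op: "linear_op (right_op m c g)"
  by (cases g) (simp_all add: op_linears)

lemma linear_left_op: "linear_op (left_op m c g)"
  by (cases g) (simp_all add: op_linears)

abbreviation right_rep where "right_rep m c \<equiv> right_act (right_op m c)"
abbreviation left_rep where "left_rep m c \<equiv> left_act (left_op m c)"

lemmas right_rep_mult [simp] = right_act_mult[of "right_op m c" for m c, OF linear_right_op]
lemmas left_rep_mult [simp] = left_act_mult[of "left_op m c" for m c, OF linear_left_op]

lemma K_op_Ki_op:
  assumes "c i \<noteq> 0"
  shows "K_op m c i (Ki_op m c i f) = f" "Ki_op m c i (K_op m c i f) = f"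
  using assms by (simp_all add: K_op_def Ki_op_def K_weight_nonzero flip: mult.assoc)

lemma right_rep_cartan: "right_rep m c (cartan m i) f = cartan_op m c i f"
  by (simp add: cartan_def cartan_op_def K_op_comm op_linear_simps right_diff_distrib)

lemma left_rep_cartan: "left_rep m c (cartan m i) f = cartan_op m c i f"
  by (simp add: cartan_def cartan_op_def K_op_comm op_linear_simps right_diff_distrib)

text \<open>Together these families are stable under the transposition anti-automorphism, so both
  representations respect them.\<close>

lemma right_rep_left_rep_Cartan_rels:
  assumes "\<And>i. i \<in> {1..m+n} \<Longrightarrow> c i \<noteq> 0" and "r \<in> rels_K m n \<union> rels_KEF m n \<union> rels_EF m n"
  shows "right_rep m c r f = (\<lambda>u. 0)" "left_rep m c r f = (\<lambda>u. 0)"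
proof -
  have "right_rep m c r f = (\<lambda>u. 0) \<and> left_rep m c r f = (\<lambda>u. 0)" if r: "r \<in> rels_K m n"
    using r assms(1) unfolding rels_K_def by (auto simp: K_op_Ki_op K_op_comm(1))
  moreover have "right_rep m c r f = (\<lambda>u. 0) \<and> left_rep m c r f = (\<lambda>u. 0)" if r: "r \<in> rels_KEF m n"
    using r assms(1) unfolding rels_KEF_def
    by (auto simp: K_op_Ki_op K_op_comm(1) E_op_K_op E_op_Ki_op F_op_K_op F_op_Ki_op op_linear_simps K_op_Ki_op)
  moreover have "right_rep m c r f = (\<lambda>u. 0) \<and> left_rep m c r f = (\<lambda>u. 0)" if r: "r \<in> rels_EF m n"
    using r unfolding rels_EF_def
    by (auto simp: scomm_def F_op_E_op right_rep_cartan left_rep_cartan)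
  ultimately show "right_rep m c r f = (\<lambda>u. 0)" "left_rep m c r f = (\<lambda>u. 0)"
    using assms(2) by auto
qed

lemma root_E_simple: "root_E m i (Suc i) = var (GE i)"
  by (subst root_E.simps) simp
lemma root_F_simple: "root_F m i (Suc i) = var (GF i)"
  by (subst root_F.simps) simp

text \<open>The inner bracket has \<open>c = m\<close>, with coefficient \<open>inverse qq\<close>;
  the outer one has \<open>c = m + 1\<close>, beyond the odd root, where
  \<open>inverse (qi m c)\<close> is \<open>qq\<close>.\<close>

lemma root_E_super:
  "root_E (Suc k) k (Suc (Suc (Suc k))) =
    (var (GE k) * var (GE (Suc k)) - scalar (inverse qq) * var (GE (Suc k)) * var (GE k)) * var (GE (Suc (Suc k)))
    - scalar qq * var (GE (Suc (Suc k))) * (var (GE k) * var (GE (Suc k)) - scalar (inverse qq) * var (GE (Suc k)) * var (GE k))"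
  by (subst root_E.simps) (simp add: root_E_simple qi_def root_E.simps[of _ k "Suc (Suc k)"])

lemma root_F_super:
  "root_F (Suc k) k (Suc (Suc (Suc k))) =
    - scalar (inverse qq) * (- scalar qq * var (GF k) * var (GF (Suc k)) + var (GF (Suc k)) * var (GF k)) * var (GF (Suc (Suc k)))
    + var (GF (Suc (Suc k))) * (- scalar qq * var (GF k) * var (GF (Suc k)) + var (GF (Suc k)) * var (GF k))"
  by (subst root_F.simps) (simp add: root_F_simple qi_def root_F.simps[of _ k "Suc (Suc k)"])

text \<open>A relation among the raising generators is expressed by \<open>E_op\<close> in
  \<open>right_rep\<close>, one among the lowering generators in \<open>left_rep\<close>; the
  operator identities above apply in the respective case.\<close>

lemma right_rep_or_left_rep_rels:
  assumes "r \<in> rels_odd m \<union> rels_far m n \<union> rels_serre m n \<union> rels_super m n"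
  shows "(\<forall>f. right_rep m c r f = (\<lambda>u. 0)) \<or> (\<forall>f. left_rep m c r f = (\<lambda>u. 0))"
proof -
  let ?P = "\<lambda>r. (\<forall>f. right_rep m c r f = (\<lambda>u. 0)) \<or> (\<forall>f. left_rep m c r f = (\<lambda>u. 0))"
  have "?P r" if "r \<in> rels_odd m"
    using that unfolding rels_odd_def by (auto simp: E_op_odd)
  moreover have "?P r" if "r \<in> rels_far m n"
  proof -
    from that obtain X i j where "X \<in> {GE, GF}" and d: "\<bar>int i - int j\<bar> > 1"
      and "r = var (X i) * var (X j) - var (X j) * var (X i)"
      unfolding rels_far_def by blast
    then have r: "r = var (GE i) * var (GE j) - var (GE j) * var (GE i) \<or>
           r = var (GF i) * var (GF j) - var (GF j) * var (GF i)"
      by blast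
    have ij: "i \<noteq> j" "i \<noteq> Suc j" "j \<noteq> Suc i"
      using d by auto
    from r show ?thesis
      by (elim disjE) (simp_all add: E_op_far[OF ij])
  qed
  moreover have "?P r" if "r \<in> rels_serre m n"
  proof -
    from that obtain X i j where "X \<in> {GE, GF}" and d: "\<bar>int i - int j\<bar> = 1" "i \<noteq> m"
      and "r = serre (var (X i)) (var (X j))"
      unfolding rels_serre_def by blast
    then have r: "r = serre (var (GE i)) (var (GE j)) \<or> r = serre (var (GF i)) (var (GF j))"
      by blast
    have ij: "j = Suc i \<or> i = Suc j" "i \<noteq> m"
      using d by auto
    have eq: "E_op m c i (E_op m c i (E_op m c j f)) w =
        (qq + inverse qq) * E_op m c i (E_op m c j (E_op m c i f)) w - E_op m c j (E_op m c i (E_op m c i f)) w" for f w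
      using E_op_serre[OF ij, of c f w] by (simp only: eq_diff_eq)
    from r show ?thesis
      by (elim disjE) (simp_all add: serre_def op_linear_simps eq)
  qed
  moreover have "?P r" if "r \<in> rels_super m n"
  proof -
    from that have m: "2 \<le> m" and r: "r = scomm 1 1 (root_E m (m-1) (m+2)) (var (GE m)) \<or>
        r = scomm 1 1 (root_F m (m-1) (m+2)) (var (GF m))"
      unfolding rels_super_def by (auto split: if_splits)
    obtain k where k: "m = Suc k" using m by (cases m) auto
    have ad: "E_op m c k (E_op m c (Suc m) f) = E_op m c (Suc m) (E_op m c k f)" for f
      by (rule E_op_far) (auto simp: k)
    have qr: "qq * (inverse qq * x) = (x :: 'a ratfun)" "inverse qq * (qq * x) = x" for x
      by simp_all
    have eq: "E_op m c k (E_op m c m (E_op m c (Suc m) (E_op m c m f))) w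
       + E_op m c (Suc m) (E_op m c m (E_op m c k (E_op m c m f))) w
       + E_op m c m (E_op m c k (E_op m c m (E_op m c (Suc m) f))) w
       + E_op m c m (E_op m c (Suc m) (E_op m c m (E_op m c k f))) w
       = (qq + inverse qq) * E_op m c m (E_op m c k (E_op m c (Suc m) (E_op m c m f))) w" for f w
      using E_op_super[OF m, of c f w] by (simp add: k)
    from r show ?thesis
    proof
      assume r: "r = scomm 1 1 (root_E m (m-1) (m+2)) (var (GE m))"
      have "right_rep m c r f w = 0" for f w
        using eq[of f w] unfolding r scomm_def k
        by (simp add: root_E_super op_linear_simps E_op_odd ad[unfolded k], simp add: algebra_simps qr)
      then show ?thesis by (auto simp: fun_eq_iff)
    next
      assume r: "r = scomm 1 1 (root_F m (m-1) (m+2)) (var (GF m))"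
      have "left_rep m c r f w = 0" for f w
        using eq[of f w] unfolding r scomm_def k
        by (simp add: root_F_super op_linear_simps E_op_odd ad[unfolded k], simp add: algebra_simps qr)
      then show ?thesis by (auto simp: fun_eq_iff)
    qed
  qed
  ultimately show ?thesis using assms by auto
qed

section \<open>Reduction to words in the lowering generators\<close>

lemma scalar_commute: "scalar a * p = p * scalar (a :: 'k::comm_ring_1)"
  by (induction p rule: poly_mapping_linear_induct)
    (simp_all add: distrib_left distrib_right scalar_def mult_single mult.commute)

lemma scalar_mult: "scalar a * scalar b = scalar (a * b)"
  and scalar_diff: "scalar a - scalar b = scalar (a - b)"
  and scalar_1: "scalar 1 = 1"
  and scalar_0: "scalar 0 = 0"
  and scalar_minus: "scalar (- a) = - scalar a"
  by (simp_all add: scalar_def mult_single single_diff single_uminus)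

lemma scalar_mult_single: "scalar a * Poly_Mapping.single v b = Poly_Mapping.single v (a * b)"
  by (simp add: scalar_def mult_single)

lemma scalar_left_commute: "x * (scalar (a :: 'k::comm_ring_1) * y) = scalar a * (x * y)"
  by (simp only: scalar_commute[of a] mult.assoc)

lemma var_scalar: "var g * (scalar (a :: 'k::comm_ring_1) * y) = scalar a * (var g * y)"
  by (rule scalar_left_commute)

lemma scalar_mult_assoc: "scalar a * (scalar b * x) = scalar (a * b) * x"
  by (simp add: scalar_mult mult.assoc[symmetric])

definition fmon :: "nat list \<Rightarrow> gen word \<Rightarrow>\<^sub>0 'k::comm_ring_1" where
  "fmon w = Poly_Mapping.single (Word (map GF w)) 1"

lemma fmon_Nil [simp]: "fmon [] = 1"
  by (simp add: fmon_def flip: zero_word_def)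

lemma fmon_Cons: "fmon (j # w) = var (GF j) * fmon w"
  by (simp add: fmon_def var_def mult_single plus_word_def)

definition Fspan :: "nat \<Rightarrow> nat \<Rightarrow> (gen word \<Rightarrow>\<^sub>0 'k::comm_ring_1) set" where
  "Fspan m n = {p. \<forall>v\<in>Poly_Mapping.keys p. \<exists>w. set w \<subseteq> {1..<m+n} \<and> v = Word (map GF w)}"

lemma Fspan_closed:
  "0 \<in> Fspan m n" "p \<in> Fspan m n \<Longrightarrow> q \<in> Fspan m n \<Longrightarrow> p + q \<in> Fspan m n"
  "p \<in> Fspan m n \<Longrightarrow> scalar a * p \<in> Fspan m n"
  "set w \<subseteq> {1..<m+n} \<Longrightarrow> fmon w \<in> Fspan m n"
proof -
  show "p + q \<in> Fspan m n" if "p \<in> Fspan m n" "q \<in> Fspan m n"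
    using that keys_add[of p q] unfolding Fspan_def by blast
  show "scalar a * p \<in> Fspan m n" if "p \<in> Fspan m n"
  proof -
    have "Poly_Mapping.keys (scalar a * p) \<subseteq> Poly_Mapping.keys p"
      using keys_mult[of "scalar a" p] by (auto simp: scalar_def split: if_splits)
    with that show ?thesis unfolding Fspan_def by blast
  qed
qed (auto simp: Fspan_def fmon_def split: if_splits)

lemma poly_mapping_sum_single:
  "p = (\<Sum>v\<in>Poly_Mapping.keys p. Poly_Mapping.single v (Poly_Mapping.lookup p v))"
  by (rule poly_mapping_eqI)
    (auto simp: lookup_sum lookup_single when_def in_keys_iff)

text \<open>The constant term is split off because it is what the functionals read; the other terms
  belong to nonempty words, whose weights differ from \<open>c\<close>.\<close>

lemma Fspan_decompose:
  assumes "p \<in> Fspan m n"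
  obtains S b where "finite S" "[] \<notin> S" "\<And>w. w \<in> S \<Longrightarrow> set w \<subseteq> {1..<m+n}"
    "p = scalar (Poly_Mapping.lookup p 0) + (\<Sum>w\<in>S. scalar (b w) * fmon w)"
proof -
  define f where "f w = Word (map GF w)" for w
  have inj: "inj f"
    unfolding f_def by (rule injI) (auto simp: inj_map_eq_map inj_on_def)
  have f0: "f w = 0 \<longleftrightarrow> w = []" for w
    by (simp add: f_def zero_word_def)
  define S where "S = {w. w \<noteq> [] \<and> f w \<in> Poly_Mapping.keys p}"
  have im: "f ` S = Poly_Mapping.keys p - {0}"
    using assms f0 unfolding S_def Fspan_def f_def by fastforce
  have fin: "finite S"
    by (rule finite_imageD[of f]) (simp_all add: im inj_on_subset[OF inj])
  have "p = (\<Sum>v\<in>insert 0 (Poly_Mapping.keys p - {0}). Poly_Mapping.single v (Poly_Mapping.lookup p v))"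
    by (subst poly_mapping_sum_single) (rule sum.mono_neutral_left, auto simp: in_keys_iff)
  also have "\<dots> = scalar (Poly_Mapping.lookup p 0)
      + (\<Sum>v\<in>f ` S. Poly_Mapping.single v (Poly_Mapping.lookup p v))"
    by (subst sum.insert) (simp_all add: im scalar_def)
  also have "(\<Sum>v\<in>f ` S. Poly_Mapping.single v (Poly_Mapping.lookup p v))
     = (\<Sum>w\<in>S. scalar (Poly_Mapping.lookup p (f w)) * fmon w)"
    by (subst sum.reindex[OF inj_on_subset[OF inj subset_UNIV]])
      (simp add: fmon_def scalar_mult_single f_def)
  finally have eq: "p = scalar (Poly_Mapping.lookup p 0)
      + (\<Sum>w\<in>S. scalar (Poly_Mapping.lookup p (f w)) * fmon w)" .
  show thesis
  proof (rule that[OF fin _ _ eq])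
    show "set w \<subseteq> {1..<m+n}" if "w \<in> S" for w
    proof -
      from that have "f w \<in> Poly_Mapping.keys p" by (simp add: S_def)
      with assms obtain w' where "set w' \<subseteq> {1..<m+n}" "f w = f w'"
        unfolding Fspan_def f_def by blast
      with inj show ?thesis by (metis injD)
    qed
  qed (simp add: S_def)
qed

lemma fmon_closed: "set w \<subseteq> {1..<m+n} \<Longrightarrow> fmon w \<in> carrier (free_alg m n)"
  by (rule free_alg_memI) (auto simp: fmon_def gens_def split: if_splits)

text \<open>Monomials are built by left multiplication with generators, the operation compatible
  with congruence modulo a left ideal; general elements are then sums of scaled monomials.\<close>

lemma free_alg_induct [consumes 1, case_names one mult add scale]:
  assumes "z \<in> carrier (free_alg m n)"
    and "P 1" "\<And>g x. g \<in> gens m n \<Longrightarrow> x \<in> carrier (free_alg m n) \<Longrightarrow> P x \<Longrightarrow> P (var g * x)"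
    and "\<And>x y. x \<in> carrier (free_alg m n) \<Longrightarrow> y \<in> carrier (free_alg m n) \<Longrightarrow> P x \<Longrightarrow> P y \<Longrightarrow> P (x + y)"
    and "\<And>a x. x \<in> carrier (free_alg m n) \<Longrightarrow> P x \<Longrightarrow> P (scalar a * x)"
  shows "P (z :: 'f::field_char_0 free)"
proof -
  let ?m = "\<lambda>gs. Poly_Mapping.single (Word gs) 1 :: 'f free"
  have mon: "?m gs \<in> carrier (free_alg m n) \<and> P (?m gs)" if "set gs \<subseteq> gens m n" for gs
    using that
  proof (induction gs)
    case Nil
    then show ?case using assms(2) free_alg_1 by (simp flip: zero_word_def)
  next
    case (Cons g gs)
    have "?m (g # gs) = var g * ?m gs"
      by (simp add: var_def mult_single plus_word_def)
    with Cons assms(3) show ?case by (auto intro!: free_alg_intros)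
  qed
  have single: "Poly_Mapping.single v a \<in> carrier (free_alg m n) \<and> P (Poly_Mapping.single v a)"
    if "set (letters v) \<subseteq> gens m n" for v a
  proof -
    have "Poly_Mapping.single v a = scalar a * ?m (letters v)"
      by (simp add: scalar_mult_single)
    then show ?thesis using mon[OF that] assms(5) by (auto intro!: free_alg_intros)
  qed
  have "finite S \<Longrightarrow> (\<And>v. v \<in> S \<Longrightarrow> set (letters v) \<subseteq> gens m n) \<Longrightarrow>
     (\<Sum>v\<in>S. Poly_Mapping.single v (b v)) \<in> carrier (free_alg m n) \<and> P (\<Sum>v\<in>S. Poly_Mapping.single v (b v))" for S b
  proof (induction S rule: finite_induct)
    case empty
    have "P (scalar 0 * 1)" using assms(2,5) free_alg_1 by blast
    then show ?case by (simp add: scalar_0 free_alg_0)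
  next
    case (insert v S)
    then show ?case using single assms(4) by (auto intro!: free_alg_intros)
  qed
  from this[of "Poly_Mapping.keys z" "Poly_Mapping.lookup z"] show ?thesis
    using assms(1) by (auto simp flip: poly_mapping_sum_single dest: free_alg_memD)
qed

text \<open>The left ideals that can annihilate a vector of weight \<open>c\<close> killed by all $E_{i,i+1}$. Only the
  first three families of relations are imposed, since \<open>eps'\<close> is not yet known to respect
  the others when the two functionals are compared.\<close>

locale hw_ideal =
  fixes m n :: nat and c :: "nat \<Rightarrow> 'f::field_char_0 ratfun" and Q :: "'f free set"
  assumes c_nonzero: "\<And>i. i \<in> {1..m+n} \<Longrightarrow> c i \<noteq> 0"
    and closed: "Q \<subseteq> carrier (free_alg m n)"
    and zero: "0 \<in> Q"
    and add: "x \<in> Q \<Longrightarrow> y \<in> Q \<Longrightarrow> x + y \<in> Q"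
    and lmult: "y \<in> carrier (free_alg m n) \<Longrightarrow> x \<in> Q \<Longrightarrow> y * x \<in> Q"
    and rels: "r \<in> rels_K m n \<union> rels_KEF m n \<union> rels_EF m n \<Longrightarrow>
      z \<in> carrier (free_alg m n) \<Longrightarrow> r * z \<in> Q"
    and E: "i \<in> {1..<m+n} \<Longrightarrow> var (GE i) \<in> Q"
    and K: "i \<in> {1..m+n} \<Longrightarrow> var (GK i) - scalar (c i) \<in> Q"
begin

abbreviation "C \<equiv> carrier (free_alg m n :: 'f free ring)"

lemma uminus: "x \<in> Q \<Longrightarrow> - x \<in> Q"
  using lmult[OF free_alg_scalar[of "- 1"]] by (simp add: scalar_minus scalar_1)

definition cong :: "'f free \<Rightarrow> 'f free \<Rightarrow> bool" (infix "\<approx>" 50) where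
  "x \<approx> y \<longleftrightarrow> x - y \<in> Q"

lemma cong_refl: "x \<approx> x"
  by (simp add: cong_def zero)

lemma cong_sym: "x \<approx> y \<Longrightarrow> y \<approx> x"
  using uminus[of "x - y"] by (simp add: cong_def)

lemma cong_trans [trans]: "x \<approx> y \<Longrightarrow> y \<approx> z \<Longrightarrow> x \<approx> z"
  using add[of "x - y" "y - z"] by (simp add: cong_def)

lemma cong_add: "x \<approx> y \<Longrightarrow> x' \<approx> y' \<Longrightarrow> x + x' \<approx> y + y'"
  using add[of "x - y" "x' - y'"] by (simp add: cong_def algebra_simps)

lemma cong_lmult: "z \<in> C \<Longrightarrow> x \<approx> y \<Longrightarrow> z * x \<approx> z * y"
  using lmult[of z "x - y"] by (simp add: cong_def algebra_simps)

lemma cong_uminus: "x \<approx> y \<Longrightarrow> - x \<approx> - y"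
  using uminus[of "x - y"] by (simp add: cong_def)

lemma cong_diff: "x \<approx> y \<Longrightarrow> x' \<approx> y' \<Longrightarrow> x - x' \<approx> y - y'"
  using cong_add[of x y "- x'" "- y'"] cong_uminus by simp

text \<open>Congruence modulo a left ideal is stable only under left multiplication. The defining
  relations are the exception: they may be applied in front of any further factor
  \<open>z\<close>.\<close>

lemma cong_rel: "x - y \<in> rels_K m n \<union> rels_KEF m n \<union> rels_EF m n \<Longrightarrow> z \<in> C \<Longrightarrow> x * z \<approx> y * z"
  using rels[of "x - y" z] by (simp add: cong_def left_diff_distrib)

lemma cong_in: "x \<approx> y \<Longrightarrow> x \<in> Q \<longleftrightarrow> y \<in> Q"
  using add[of "x - y" y] add[of "y - x" x] cong_sym[of x y] by (auto simp: cong_def)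

lemma KKi: "i \<in> {1..m+n} \<Longrightarrow> z \<in> C \<Longrightarrow> var (GKi i) * var (GK i) * z \<approx> z"
  using cong_rel[of "var (GKi i) * var (GK i)" 1 z] by (auto simp: rels_K_def)

lemma K_fmon:
  assumes "i \<in> {1..m+n}" "set w \<subseteq> {1..<m+n}"
  shows "var (GK i) * fmon w \<approx> scalar (K_weight m c i w) * fmon w"
  using assms(2)
proof (induction w)
  case Nil
  then show ?case using K[OF assms(1)] by (simp add: cong_def)
next
  case (Cons j w)
  let ?s = "qi m i powi (- wt i j) :: 'f ratfun"
  from Cons have j: "j \<in> {1..<m+n}" and w: "set w \<subseteq> {1..<m+n}" by auto
  note mem = free_alg_intros free_alg_gen fmon_closed[OF w]
  have KC: "var (GK i) \<in> C" and FC: "var (GF j) \<in> C"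
    using assms j by (auto intro!: free_alg_gen)
  have "var (GK i) * fmon (j # w) = (var (GK i) * var (GF j)) * fmon w"
    by (simp add: fmon_Cons mult.assoc)
  \<comment> \<open>The commutation rule is available only in the conjugated form of
    \<open>rels_KEF\<close>, so \<open>K_i^{-1} K_i\<close> is inserted before the remaining
    word.\<close>
  also have "\<dots> \<approx> (var (GK i) * var (GF j)) * (var (GKi i) * var (GK i) * fmon w)"
    by (intro cong_lmult cong_sym[OF KKi] mem KC FC assms)
  also have "\<dots> = (var (GK i) * var (GF j) * var (GKi i)) * (var (GK i) * fmon w)"
    by (simp add: mult.assoc)
  also have "\<dots> \<approx> (scalar ?s * var (GF j)) * (var (GK i) * fmon w)"
    using assms(1) j by (intro cong_rel mem KC FC) (auto simp: rels_KEF_def)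
  also have "\<dots> \<approx> (scalar ?s * var (GF j)) * (scalar (K_weight m c i w) * fmon w)"
    using Cons w by (intro cong_lmult mem KC FC) auto
  also have "\<dots> = scalar (K_weight m c i (j # w)) * fmon (j # w)"
    by (simp add: fmon_Cons K_weight_Cons mult.assoc var_scalar scalar_mult_assoc mult.commute)
  finally show ?case .
qed

lemma Ki_fmon:
  assumes "i \<in> {1..m+n}" "set w \<subseteq> {1..<m+n}"
  shows "var (GKi i) * fmon w \<approx> scalar (inverse (K_weight m c i w)) * fmon w"
proof -
  let ?k = "K_weight m c i w"
  have k: "?k \<noteq> 0" using c_nonzero[OF assms(1)] by (rule K_weight_nonzero)
  have KC: "var (GKi i) \<in> C" "fmon w \<in> C"
    using assms by (auto intro!: free_alg_gen fmon_closed)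
  \<comment> \<open>The eigenvalue and its inverse are inserted so that the eigenvalue can be traded
    for \<open>K_i\<close>, which then cancels.\<close>
  have "var (GKi i) * fmon w = scalar (inverse ?k) * (var (GKi i) * (scalar ?k * fmon w))"
    by (simp add: var_scalar scalar_mult_assoc k scalar_1)
  also have "\<dots> \<approx> scalar (inverse ?k) * (var (GKi i) * (var (GK i) * fmon w))"
    using assms by (intro cong_lmult free_alg_scalar KC cong_sym[OF K_fmon])
  also have "\<dots> \<approx> scalar (inverse ?k) * fmon w"
    using KKi[OF assms(1) KC(2)] by (intro cong_lmult free_alg_scalar) (simp add: mult.assoc)
  finally show ?thesis .
qed

section \<open>Every element reduces to a combination of words in the lowering generators\<close>

definition reducible :: "'f free \<Rightarrow> bool" where
  "reducible z \<longleftrightarrow> (\<exists>p\<in>Fspan m n. z \<approx> p)"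

lemma reducible_add: "reducible x \<Longrightarrow> reducible y \<Longrightarrow> reducible (x + y)"
  unfolding reducible_def using cong_add Fspan_closed(2) by blast

lemma reducible_scale: "reducible x \<Longrightarrow> reducible (scalar a * x)"
  unfolding reducible_def using cong_lmult[OF free_alg_scalar] Fspan_closed(3) by blast

lemma reducible_minus: "reducible x \<Longrightarrow> reducible (- x)"
  using reducible_scale[of x "- 1"] by (simp add: scalar_minus scalar_1)

lemma reducible_cong: "x \<approx> y \<Longrightarrow> reducible y \<Longrightarrow> reducible x"
  unfolding reducible_def using cong_trans by blast

lemma reducible_fmon: "set w \<subseteq> {1..<m+n} \<Longrightarrow> reducible (fmon w)"
  unfolding reducible_def using Fspan_closed(4) cong_refl by blast

lemma reducible_0: "reducible 0"
  unfolding reducible_def by (rule bexI[OF cong_refl Fspan_closed(1)])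

lemma reducible_sum: "(\<And>w. w \<in> S \<Longrightarrow> reducible (f w)) \<Longrightarrow> reducible (sum f S)"
proof (induction S rule: infinite_finite_induct)
  case (insert w S)
  then show ?case by (simp add: reducible_add)
qed (simp_all add: reducible_0)

lemma reducible_lmult:
  assumes "x \<in> C" "\<And>w. set w \<subseteq> {1..<m+n} \<Longrightarrow> reducible (x * fmon w)" "reducible z"
  shows "reducible (x * z)"
proof -
  from assms(3) obtain p where p: "p \<in> Fspan m n" "z \<approx> p"
    unfolding reducible_def by blast
  obtain S b where "finite S" "[] \<notin> S" and S: "\<And>w. w \<in> S \<Longrightarrow> set w \<subseteq> {1..<m+n}"
    "p = scalar (Poly_Mapping.lookup p 0) + (\<Sum>w\<in>S. scalar (b w) * fmon w)"
    by (rule Fspan_decompose[OF p(1)]) blast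
  have *: "reducible (x * (scalar a * fmon w))" if "set w \<subseteq> {1..<m+n}" for a w
    using reducible_scale[OF assms(2)[OF that], of a] by (simp add: scalar_left_commute)
  have "x * p = x * (scalar (Poly_Mapping.lookup p 0) * fmon []) + (\<Sum>w\<in>S. x * (scalar (b w) * fmon w))"
    by (subst S(2)) (simp add: distrib_left sum_distrib_left)
  also have "reducible \<dots>"
    using S(1) by (intro reducible_add reducible_sum *) auto
  finally show ?thesis
    using reducible_cong cong_lmult[OF assms(1) p(2)] by blast
qed

lemma reducible_F:
  assumes "j \<in> {1..<m+n}" "reducible z" shows "reducible (var (GF j) * z)"
proof (rule reducible_lmult)
  show "var (GF j) \<in> C" using assms(1) by (auto intro: free_alg_gen)
  show "reducible (var (GF j) * fmon w)" if "set w \<subseteq> {1..<m+n}" for w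
    using reducible_fmon[of "j # w"] assms(1) that by (simp add: fmon_Cons)
qed fact

lemma reducible_K:
  assumes "i \<in> {1..m+n}" "reducible z"
  shows "reducible (var (GK i) * z)" "reducible (var (GKi i) * z)"
proof -
  show "reducible (var (GK i) * z)"
    by (rule reducible_lmult[OF _ reducible_cong[OF K_fmon[OF assms(1)]] assms(2)])
      (use assms(1) in \<open>auto intro!: free_alg_gen reducible_scale reducible_fmon simp del: One_nat_def\<close>)
  show "reducible (var (GKi i) * z)"
    by (rule reducible_lmult[OF _ reducible_cong[OF Ki_fmon[OF assms(1)]] assms(2)])
      (use assms(1) in \<open>auto intro!: free_alg_gen reducible_scale reducible_fmon simp del: One_nat_def\<close>)
qed

lemma reducible_cartan:
  assumes i: "i \<in> {1..<m+n}" and w: "set w \<subseteq> {1..<m+n}"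
  shows "reducible (cartan m i * fmon w)"
proof -
  have ij: "i \<in> {1..m+n}" "i + 1 \<in> {1..m+n}" using i by auto
  have "reducible (scalar (inverse (qi m i - inverse (qi m i))) *
     (var (GK i) * (var (GKi (i+1)) * fmon w) + - (var (GKi i) * (var (GK (i+1)) * fmon w))))"
    by (intro reducible_scale reducible_add reducible_minus reducible_K ij reducible_fmon w)
  then show ?thesis
    by (simp add: cartan_def mult.assoc left_diff_distrib)
qed

text \<open>The raising generator travels to the right through the word; each letter passed leaves a
  Cartan term, and at the end of the word it lies in \<open>Q\<close>.\<close>

lemma reducible_E_fmon:
  assumes i: "i \<in> {1..<m+n}" and w: "set w \<subseteq> {1..<m+n}"
  shows "reducible (var (GE i) * fmon w)"
  using w
proof (induction w)
  case Nil
  have "var (GE i) \<approx> 0" using E[OF i] by (simp add: cong_def)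
  then show ?case using Fspan_closed(1) by (auto simp: reducible_def)
next
  case (Cons j w)
  then have j: "j \<in> {1..<m+n}" and w: "set w \<subseteq> {1..<m+n}" by auto
  \<comment> \<open>The sign and the Cartan summand that appear when the relation in
    \<open>rels_EF\<close> is solved for the product of the raising generator with the
    letter.\<close>
  define s :: "'f free" where "s = (if i = m \<and> j = m then - 1 else 1)"
  define h :: "'f free" where "h = (if i = j then cartan m i else 0)"
  have "var (GE i) * var (GF j) - (s * var (GF j) * var (GE i) + h) \<in> rels_EF m n"
    using i j unfolding rels_EF_def s_def h_def
    by (intro CollectI exI[of _ i] exI[of _ j]) (auto simp: scomm_def)
  then have "var (GE i) * var (GF j) * fmon w \<approx> (s * var (GF j) * var (GE i) + h) * fmon w"
    by (intro cong_rel fmon_closed w) auto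
  moreover have "reducible (h * fmon w)"
    using reducible_cartan[OF i w] reducible_sum[of "{}"] by (auto simp: h_def)
  moreover have "reducible (s * (var (GF j) * (var (GE i) * fmon w)))"
    using reducible_F[OF j Cons.IH[OF w]] reducible_minus by (auto simp: s_def)
  ultimately show ?case
    using reducible_cong reducible_add by (auto simp: fmon_Cons distrib_right mult.assoc)
qed

text \<open>In module terms: a vector of weight \<open>c\<close> killed by all raising generators
  generates only the span of the products of lowering generators applied to it. That span is stable
  under each of the four kinds of generators.\<close>

theorem all_reducible: "z \<in> C \<Longrightarrow> reducible z"
proof (induction z rule: free_alg_induct)
  case one
  then show ?case using reducible_fmon[of "[]"] by simp
next
  case (mult g x)
  from mult(1) consider j where "g = GE j" "j \<in> {1..<m+n}" | j where "g = GF j" "j \<in> {1..<m+n}"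
    | j where "g = GK j" "j \<in> {1..m+n}" | j where "g = GKi j" "j \<in> {1..m+n}"
    unfolding gens_def by blast
  then show ?case
  proof cases
    case 1
    show ?thesis unfolding 1(1)
      by (rule reducible_lmult[OF _ reducible_E_fmon mult(3)]) (use 1(2) in \<open>auto intro: free_alg_gen\<close>)
  qed (simp_all only: reducible_F reducible_K mult(3))
qed (auto intro: reducible_add reducible_scale)

section \<open>Separating the constant term by weights\<close>

lemma wt_self: "wt i i = 1"
  by (simp add: wt_def)

text \<open>Take the least letter \<open>i\<close> of the word. A negative contribution to the
  exponent of \<open>K_i\<close> would come from the letter \<open>i - 1\<close>, which does not
  occur, so the exponent is nonzero.\<close>

lemma weight_separated:
  assumes "w \<noteq> []" "set w \<subseteq> {1..<m+n}"
  obtains i where "i \<in> {1..m+n}" "K_weight m c i w \<noteq> c i"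
proof -
  obtain i where i: "i \<in> set w" and min: "\<And>j. j \<in> set w \<Longrightarrow> i \<le> j"
    using that[of "Min (set w)"] assms(1) by simp
  have nn: "j \<in> set w \<Longrightarrow> wt i j \<ge> 0" for j
    using min[of j] by (force simp: wt_def)
  have "(\<Sum>j\<leftarrow>v. wt i j) \<ge> 0 \<and> (i \<in> set v \<longrightarrow> (\<Sum>j\<leftarrow>v. wt i j) > 0)" if "set v \<subseteq> set w" for v
    using that
  proof (induction v)
    case (Cons j v)
    then show ?case using nn[of j] by (auto simp: wt_self)
  qed simp
  from this[of w] i have pos: "(\<Sum>j\<leftarrow>w. wt i j) > 0" by auto
  have ii: "i \<in> {1..m+n}" using i assms(2) by fastforce
  have "K_weight m c i w \<noteq> c i"
  proof
    assume "K_weight m c i w = c i"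
    then have "qi m i powi (- (\<Sum>j\<leftarrow>w. wt i j)) = (1 :: 'f ratfun)"
      using c_nonzero[OF ii] by (simp add: K_weight_def)
    from qi_powi_eq_1[OF this] pos show False by simp
  qed
  with ii show thesis by (rule that)
qed

text \<open>Applying \<open>K_i\<close> minus its eigenvalue on \<open>v\<close> removes the term of
  \<open>v\<close>, rescales the others and multiplies the constant term by the nonzero number
  \<open>c i - K_weight m c i v\<close>. Hence the coefficients vary in the induction.\<close>

lemma scalar_part_in:
  assumes "finite S" "\<And>w. w \<in> S \<Longrightarrow> w \<noteq> [] \<and> set w \<subseteq> {1..<m+n}"
    and "scalar a + (\<Sum>w\<in>S. scalar (b w) * fmon w) \<in> Q"
  shows "scalar a \<in> Q"
  using assms
proof (induction S arbitrary: a b rule: finite_induct)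
  case empty
  then show ?case by simp
next
  case (insert v S)
  then obtain i where i: "i \<in> {1..m+n}" and ne: "K_weight m c i v \<noteq> c i"
    by (metis weight_separated insertI1)
  let ?k = "K_weight m c i v"
  have KC: "var (GK i) - scalar ?k \<in> C"
    using i by (intro free_alg_intros free_alg_gen) auto
  have act: "(var (GK i) - scalar ?k) * (scalar b * fmon w) \<approx> scalar (b * (K_weight m c i w - ?k)) * fmon w"
    if "set w \<subseteq> {1..<m+n}" for b w
  proof -
    have "(var (GK i) - scalar ?k) * (scalar b * fmon w) = scalar b * ((var (GK i) * fmon w) - scalar ?k * fmon w)"
      by (simp add: mult.assoc left_diff_distrib var_scalar right_diff_distrib scalar_mult_assoc mult.commute)
    also have "\<dots> \<approx> scalar b * (scalar (K_weight m c i w) * fmon w - scalar ?k * fmon w)"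
      by (intro cong_lmult free_alg_scalar cong_diff cong_refl K_fmon i that)
    also have "\<dots> = scalar (b * (K_weight m c i w - ?k)) * fmon w"
      by (simp add: left_diff_distrib[symmetric] scalar_diff mult.assoc[symmetric] scalar_mult)
    finally show ?thesis .
  qed
  have cong_sum: "(\<Sum>w\<in>T. f w) \<approx> (\<Sum>w\<in>T. g w)" if "\<And>w. w \<in> T \<Longrightarrow> f w \<approx> g w" for T f g
    using that by (induction T rule: infinite_finite_induct) (auto intro: cong_refl cong_add)
  have "(var (GK i) - scalar ?k) * (scalar a + (\<Sum>w\<in>insert v S. scalar (b w) * fmon w)) \<in> Q"
    using insert.prems by (intro lmult KC)
  also have "(var (GK i) - scalar ?k) * (scalar a + (\<Sum>w\<in>insert v S. scalar (b w) * fmon w))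
     = (var (GK i) - scalar ?k) * (scalar a * fmon [])
       + (\<Sum>w\<in>insert v S. (var (GK i) - scalar ?k) * (scalar (b w) * fmon w))"
    (is "_ = ?R")
    by (simp add: distrib_left sum_distrib_left)
  finally have 1: "?R \<in> Q" .
  have "?R \<approx> scalar (a * (K_weight m c i [] - ?k)) * fmon [] + (\<Sum>w\<in>insert v S. scalar (b w * (K_weight m c i w - ?k)) * fmon w)"
    using insert.prems by (intro cong_add cong_sum act) auto
  also have "\<dots> = scalar (a * (c i - ?k)) + (\<Sum>w\<in>S. scalar (b w * (K_weight m c i w - ?k)) * fmon w)"
    using insert.hyps by (simp add: scalar_0)
  finally have "scalar (a * (c i - ?k)) + (\<Sum>w\<in>S. scalar (b w * (K_weight m c i w - ?k)) * fmon w) \<in> Q"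
    using 1 cong_in by blast
  then have "scalar (a * (c i - ?k)) \<in> Q"
    using insert.prems by (intro insert.IH) auto
  then have "scalar (inverse (c i - ?k)) * scalar (a * (c i - ?k)) \<in> Q"
    by (intro lmult free_alg_scalar)
  moreover have "inverse (c i - ?k) * (a * (c i - ?k)) = a"
    using ne by simp
  ultimately show ?case by (simp only: scalar_mult)
qed

lemma Fspan_part_in:
  assumes "p \<in> Fspan m n" "p \<in> Q"
  shows "scalar (Poly_Mapping.lookup p 0) \<in> Q"
proof -
  obtain S b where S: "finite S" "[] \<notin> S" "\<And>w. w \<in> S \<Longrightarrow> set w \<subseteq> {1..<m+n}"
    "p = scalar (Poly_Mapping.lookup p 0) + (\<Sum>w\<in>S. scalar (b w) * fmon w)"
    by (rule Fspan_decompose[OF assms(1)]) blast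
  show ?thesis
    by (rule scalar_part_in[OF S(1), of _ b]) (use S(2,3) S(4)[symmetric] assms(2) in auto)
qed

end

section \<open>The Harish-Chandra functional\<close>

definition vacuum :: "nat list \<Rightarrow> 'f::field_char_0 ratfun" where
  "vacuum w = (if w = [] then 1 else 0)"

text \<open>As operators are transposed, the coefficient of the empty word in \<open>p\<close>
  applied to the empty word is found by acting on its coordinate function \<open>vacuum\<close> and
  evaluating at the empty word.\<close>

definition eps :: "nat \<Rightarrow> (nat \<Rightarrow> 'f::field_char_0 ratfun) \<Rightarrow> 'f free \<Rightarrow> 'f ratfun" where
  "eps m c p = right_rep m c p vacuum []"

definition eps' :: "nat \<Rightarrow> (nat \<Rightarrow> 'f::field_char_0 ratfun) \<Rightarrow> 'f free \<Rightarrow> 'f ratfun" where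
  "eps' m c p = left_rep m c p vacuum []"

lemma eps_simps [simp]: "eps m c 0 = 0" "eps m c 1 = 1" "eps m c (x + y) = eps m c x + eps m c y"
  "eps m c (x - y) = eps m c x - eps m c y" "eps m c (scalar a * x) = a * eps m c x"
  by (simp_all add: eps_def linear_op_scale[OF right_act_linear[OF linear_right_op]]) (simp add: vacuum_def)

lemma eps'_simps [simp]: "eps' m c 0 = 0" "eps' m c 1 = 1" "eps' m c (x + y) = eps' m c x + eps' m c y"
  "eps' m c (x - y) = eps' m c x - eps' m c y" "eps' m c (scalar a * x) = a * eps' m c x"
  by (simp_all add: eps'_def) (simp add: vacuum_def)

lemma eps_scalar [simp]: "eps m c (scalar a) = a" "eps' m c (scalar a) = a"
  using eps_simps(5)[of m c a 1] eps'_simps(5)[of m c a 1] by simp_all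

lemmas right_rep_zero = linear_op_zero[OF right_act_linear[OF linear_right_op]]
lemmas left_rep_zero = linear_op_zero[OF left_act_linear[OF linear_left_op]]

text \<open>This makes \<open>eps\<close> vanish on right multiples of lowering generators and
  \<open>eps'\<close> on left multiples of raising ones; the two other vanishing properties come
  from \<open>E_op_Nil\<close>.\<close>

lemma F_op_vacuum: "F_op j vacuum = (\<lambda>w. 0)"
  by (simp add: F_op_def vacuum_def)

lemma K_op_vacuum: "K_op m c i vacuum = (\<lambda>w. c i * vacuum w)"
  by (auto simp: K_op_def vacuum_def fun_eq_iff)

lemma eps_fmon: "w \<noteq> [] \<Longrightarrow> eps m c (fmon w) = 0" "w \<noteq> [] \<Longrightarrow> eps' m c (fmon w) = 0"
  by (cases w; simp add: fmon_Cons eps_def eps'_def F_op_vacuum right_rep_zero)+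

lemma eps_Fspan:
  assumes "p \<in> Fspan m n"
  shows "eps k c p = Poly_Mapping.lookup p 0" "eps' k c p = Poly_Mapping.lookup p 0"
proof -
  obtain S b where S: "finite S" "[] \<notin> S"
    "p = scalar (Poly_Mapping.lookup p 0) + (\<Sum>w\<in>S. scalar (b w) * fmon w)"
    by (rule Fspan_decompose[OF assms]) blast
  have "eps k c (\<Sum>w\<in>S. scalar (b w) * fmon w) = 0 \<and> eps' k c (\<Sum>w\<in>S. scalar (b w) * fmon w) = 0"
    using S(1,2)
  proof (induction S rule: finite_induct)
    case (insert w S)
    then have "w \<noteq> []" by auto
    with insert show ?case by (simp add: eps_fmon)
  qed simp
  then show "eps k c p = Poly_Mapping.lookup p 0" "eps' k c p = Poly_Mapping.lookup p 0"
    by (subst S(3), simp)+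
qed

text \<open>The set is the largest left ideal on which \<open>e\<close> vanishes; the construction
  is needed for both \<open>eps\<close> and \<open>eps'\<close>.\<close>

lemma hw_idealI:
  fixes e :: "'f::field_char_0 free \<Rightarrow> 'f ratfun"
  assumes c: "\<And>i. i \<in> {1..m+n} \<Longrightarrow> c i \<noteq> 0"
    and "e 0 = 0" "\<And>x y. e (x + y) = e x + e y"
    and "\<And>r y z. r \<in> rels_K m n \<union> rels_KEF m n \<union> rels_EF m n \<Longrightarrow> e (y * r * z) = 0"
    and "\<And>i y. i \<in> {1..<m+n} \<Longrightarrow> e (y * var (GE i)) = 0"
    and "\<And>i y. i \<in> {1..m+n} \<Longrightarrow> e (y * (var (GK i) - scalar (c i))) = 0"
    and mn: "1 \<le> m" "1 \<le> n"
  shows "hw_ideal m n c {x \<in> carrier (free_alg m n). \<forall>y\<in>carrier (free_alg m n). e (y * x) = 0}"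
proof
  let ?P = "{x \<in> carrier (free_alg m n). \<forall>y\<in>carrier (free_alg m n). e (y * x) = 0}"
  show "x + y \<in> ?P" if "x \<in> ?P" "y \<in> ?P" for x y
    using that assms by (auto simp: distrib_left intro: free_alg_intros)
  show "y * x \<in> ?P" if "y \<in> carrier (free_alg m n)" "x \<in> ?P" for x y
    using that by (auto simp: mult.assoc[symmetric] intro: free_alg_intros)
  show "r * z \<in> ?P" if "r \<in> rels_K m n \<union> rels_KEF m n \<union> rels_EF m n" "z \<in> carrier (free_alg m n)" for r z
    using that assms(4)[OF that(1), of _ z] rels_closed[OF mn] unfolding rels_def
    by (auto simp: mult.assoc[symmetric] intro!: free_alg_intros)
  show "var (GE i) \<in> ?P" if "i \<in> {1..<m+n}" for i
    using that assms(5)[OF that] by (auto intro!: free_alg_gen)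
  show "var (GK i) - scalar (c i) \<in> ?P" if "i \<in> {1..m+n}" for i
    using that assms(6)[OF that] by (auto intro!: free_alg_closed(3) free_alg_scalar free_alg_gen)
qed (use assms free_alg_0 in auto)

text \<open>Reducing modulo an intersection yields one normal form valid modulo both ideals.\<close>

lemma hw_ideal_Int:
  assumes "hw_ideal m n c P" "hw_ideal m n c Q"
  shows "hw_ideal m n c (P \<inter> Q)"
proof -
  interpret P: hw_ideal m n c P by fact
  interpret Q: hw_ideal m n c Q by fact
  show ?thesis
    by standard (use P.c_nonzero P.closed in \<open>auto intro: P.zero Q.zero P.add Q.add P.lmult Q.lmult
      P.rels Q.rels P.E Q.E P.K Q.K simp del: One_nat_def\<close>)
qed

section \<open>The largest proper left ideal of highest weight type\<close>

locale weight =
  fixes m n :: nat and c :: "nat \<Rightarrow> 'f::field_char_0 ratfun"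
  assumes mn: "1 \<le> m" "1 \<le> n" and c: "c \<in> weights m n"
begin

lemma c_nonzero: "i \<in> {1..m+n} \<Longrightarrow> c i \<noteq> 0"
  using c by (auto simp: weights_def)

abbreviation "C \<equiv> carrier (free_alg m n :: 'f free ring)"

definition P :: "'f free set" where
  "P = {x \<in> C. \<forall>y\<in>C. eps m c (y * x) = 0}"

lemma hw_ideal_P: "hw_ideal m n c P"
  unfolding P_def
proof (rule hw_idealI)
  show "eps m c (y * r * z) = 0" if "r \<in> rels_K m n \<union> rels_KEF m n \<union> rels_EF m n" for r y z
    using right_rep_left_rep_Cartan_rels(1)[OF c_nonzero that] by (simp add: eps_def right_rep_zero)
  show "eps m c (y * (var (GK i) - scalar (c i))) = 0" for i y
    by (simp add: eps_def K_op_def)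
qed (use c_nonzero mn in \<open>simp_all add: eps_def\<close>)

lemma hw_ideal_P': "hw_ideal m n c {x \<in> C. \<forall>y\<in>C. eps' m c (y * x) = 0}"
proof (rule hw_idealI)
  show "eps' m c (y * r * z) = 0" if "r \<in> rels_K m n \<union> rels_KEF m n \<union> rels_EF m n" for r y z
    using right_rep_left_rep_Cartan_rels(2)[OF c_nonzero that] by (simp add: eps'_def left_rep_zero)
  show "eps' m c (y * (var (GK i) - scalar (c i))) = 0" for i y
    by (simp add: eps'_def K_op_vacuum left_rep_zero)
  show "eps' m c (y * var (GE i)) = 0" for i y
    by (simp add: eps'_def F_op_vacuum left_rep_zero)
qed (use c_nonzero mn in simp_all)

text \<open>Reduce \<open>z\<close> modulo \<open>Q\<close> and \<open>P\<close> at once. Modulo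
  \<open>P\<close> the constant term of the normal form is \<open>eps m c z\<close>; modulo
  \<open>Q\<close> the normal form is zero, so \<open>Q\<close> contains its constant term.\<close>

lemma eps_in:
  assumes "hw_ideal m n c Q" "z \<in> Q" shows "scalar (eps m c z) \<in> Q"
proof -
  interpret Q: hw_ideal m n c Q by fact
  interpret QP: hw_ideal m n c "Q \<inter> P"
    by (rule hw_ideal_Int[OF assms(1) hw_ideal_P])
  from assms(2) Q.closed have "z \<in> C" by blast
  from QP.all_reducible[OF this] obtain p where p: "p \<in> Fspan m n" "z - p \<in> Q \<inter> P"
    unfolding QP.reducible_def QP.cong_def by blast
  from p(2) have "eps m c (1 * (z - p)) = 0"
    unfolding P_def using free_alg_1 by blast
  then have e: "eps m c z = Poly_Mapping.lookup p 0"
    by (simp add: eps_Fspan[OF p(1)])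
  have "p \<in> Q"
    using p(2) assms(2) Q.cong_in[of z p] by (simp add: Q.cong_def)
  from Q.Fspan_part_in[OF p(1) this] e show ?thesis by simp
qed

text \<open>A nonzero value of \<open>eps\<close> on the left ideal would put an invertible scalar
  into it.\<close>

lemma hw_ideal_subset_P:
  assumes "hw_ideal m n c Q" "1 \<notin> Q" shows "Q \<subseteq> P"
proof
  fix z assume z: "z \<in> Q"
  interpret Q: hw_ideal m n c Q by fact
  have "eps m c (y * z) = 0" if "y \<in> C" for y
  proof (rule ccontr)
    let ?e = "eps m c (y * z)"
    assume e: "?e \<noteq> 0"
    have "scalar ?e \<in> Q" by (rule eps_in[OF assms(1) Q.lmult[OF that z]])
    then have "scalar (inverse ?e) * scalar ?e \<in> Q"
      by (intro Q.lmult free_alg_scalar)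
    with e assms(2) show False by (simp add: scalar_mult scalar_1)
  qed
  then show "z \<in> P" using z Q.closed by (auto simp: P_def)
qed

lemma one_notin_P: "1 \<notin> P"
  using free_alg_1[of m n, where 'a = 'f] by (auto simp: P_def intro!: bexI[of _ 1])

text \<open>Both functionals read the constant term of a common normal form.\<close>

lemma eps'_eq:
  assumes "z \<in> C" shows "eps' m c z = eps m c z"
proof -
  interpret PP: hw_ideal m n c "{x \<in> C. \<forall>y\<in>C. eps' m c (y * x) = 0} \<inter> P"
    by (rule hw_ideal_Int[OF hw_ideal_P' hw_ideal_P])
  from PP.all_reducible[OF assms] obtain p where p: "p \<in> Fspan m n"
     "z - p \<in> {x \<in> C. \<forall>y\<in>C. eps' m c (y * x) = 0} \<inter> P"
    unfolding PP.reducible_def PP.cong_def by blast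
  then have "eps' m c (1 * (z - p)) = 0" "eps m c (1 * (z - p)) = 0"
    unfolding P_def using free_alg_1 by blast+
  then show ?thesis by (simp add: eps_Fspan[OF p(1)])
qed

text \<open>A relation not visibly killed by \<open>right_rep\<close> is killed by
  \<open>left_rep\<close>; then \<open>eps'\<close> vanishes, and it coincides with
  \<open>eps\<close>.\<close>

lemma eps_rels:
  assumes "r \<in> rels m n" "y \<in> C" "z \<in> C"
  shows "eps m c (y * r * z) = 0"
proof (cases "\<forall>f. right_rep m c r f = (\<lambda>u. 0)")
  case True
  then show ?thesis by (simp add: eps_def right_rep_zero)
next
  case False
  with assms(1) right_rep_or_left_rep_rels[of r m n c] right_rep_left_rep_Cartan_rels(2)[of m n c r, OF c_nonzero]
  have "left_rep m c r f = (\<lambda>u. 0)" for f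
    unfolding rels_def by blast
  then have "eps' m c (y * r * z) = 0" by (simp add: eps'_def left_rep_zero)
  moreover have "y * r * z \<in> C"
    using assms rels_closed[OF mn] by (intro free_alg_intros) auto
  ultimately show ?thesis using eps'_eq by simp
qed

lemma uq_ideal_subset_P: "uq_ideal m n \<subseteq> P"
proof -
  \<comment> \<open>\<open>P\<close> is only a left ideal while \<open>uq_ideal\<close> is
    two-sided, so the comparison goes through the largest two-sided ideal on which
    \<open>eps\<close> vanishes.\<close>
  let ?I = "{r \<in> C. \<forall>y\<in>C. \<forall>z\<in>C. eps m c (y * r * z) = 0}"
  have R: "ring (free_alg m n :: 'f free ring)" by (rule ring_free_alg)
  have "ideal ?I (free_alg m n)"
  proof (rule idealI[OF ring_free_alg])
    show "subgroup ?I (add_monoid (free_alg m n))"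
    proof (rule group.subgroupI)
      show "group (add_monoid (free_alg m n :: 'f free ring))"
        using ring_free_alg abelian_group.a_group ring.is_abelian_group by blast
      have "0 \<in> ?I" by (simp add: free_alg_0)
      then show "?I \<noteq> {}" by blast
      show "inv\<^bsub>add_monoid (free_alg m n)\<^esub> a \<in> ?I" if "a \<in> ?I" for a
      proof -
        have "inv\<^bsub>add_monoid (free_alg m n)\<^esub> a = - a"
          using R that
          by (intro group.inv_equality abelian_group.a_group ring.is_abelian_group)
            (auto intro: free_alg_intros)
        moreover have "eps m c (- x) = - eps m c x" for x
          using eps_simps(4)[of m c 0 x] by (simp del: eps_simps(4))
        ultimately show ?thesis using that by (auto intro: free_alg_intros)
      qed
    qed (auto simp: distrib_left distrib_right intro: free_alg_intros)
    show "x \<otimes>\<^bsub>free_alg m n\<^esub> a \<in> ?I" if "a \<in> ?I" "x \<in> C" for a x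
      using that by (auto simp: mult.assoc[symmetric] intro: free_alg_intros)
    show "a \<otimes>\<^bsub>free_alg m n\<^esub> x \<in> ?I" if "a \<in> ?I" "x \<in> C" for a x
      using that by (auto simp: mult.assoc intro: free_alg_intros)
  qed
  moreover have "rels m n \<subseteq> ?I"
    using rels_closed[OF mn] eps_rels by blast
  ultimately have "uq_ideal m n \<subseteq> ?I"
    unfolding uq_ideal_def by (rule ring.genideal_minimal[OF ring_free_alg])
  also have "?I \<subseteq> P"
    unfolding P_def using free_alg_1 by force
  finally show ?thesis .
qed

end

section \<open>The functional vanishes on odd elements\<close>

definition odd_count :: "nat \<Rightarrow> nat list \<Rightarrow> bit" where
  "odd_count m w = (\<Sum>j\<leftarrow>w. of_bool (j = m))"

definition parity_pure :: "nat \<Rightarrow> bit \<Rightarrow> (nat list \<Rightarrow> 'k::zero) \<Rightarrow> bool" where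
  "parity_pure m p f \<longleftrightarrow> (\<forall>w. f w \<noteq> 0 \<longrightarrow> odd_count m w = p)"

text \<open>The Cartan term drops the letter \<open>i\<close> and keeps the parity of the rest; in
  the other term \<open>F_op j\<close> already shifts the parity by that of the dropped
  letter.\<close>

lemma parity_pure_E_op:
  assumes "parity_pure m p f" shows "parity_pure m (p + of_bool (i = m)) (E_op m c i f)"
proof -
  have "odd_count m w = p + of_bool (i = m)" if "parity_pure m p f" "E_op m c i f w \<noteq> 0" for w f p
    using that
  proof (induction w arbitrary: f p)
    case (Cons j w)
    show ?case
    proof (cases "E_op m c i (F_op j f) w = 0")
      case True
      with Cons.prems have "i = j" "f w \<noteq> 0"
        by (auto simp: E_op_Cons cartan_op_def K_op_def Ki_op_def split: if_splits)
      with Cons.prems show ?thesis by (auto simp: parity_pure_def odd_count_def)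
    next
      case False
      have "parity_pure m (p + of_bool (j = m)) (F_op j f)"
        using Cons.prems(1) by (auto simp: parity_pure_def F_op_def odd_count_def)
      from Cons.IH[OF this False] show ?thesis by (auto simp: odd_count_def)
    qed
  qed simp
  with assms show ?thesis by (simp add: parity_pure_def)
qed

lemma parity_pure_right_op: "parity_pure m p f \<Longrightarrow> parity_pure m (p + gen_parity m g) (right_op m c g f)"
proof (cases g)
  case (GE i)
  assume "parity_pure m p f"
  then show ?thesis unfolding GE using parity_pure_E_op[of m p f i c] by simp
next
  case (GF j)
  assume "parity_pure m p f"
  then show ?thesis unfolding GF by (auto simp: parity_pure_def F_op_def odd_count_def)
qed (auto simp: parity_pure_def K_op_def Ki_op_def)

text \<open>\<open>vacuum\<close> lives on the even empty word. An odd monomial turns it into a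
  function supported on words of odd parity, which vanishes at the empty word.\<close>

lemma eps_odd:
  assumes "x \<in> free_part m n 1" shows "eps m c x = 0"
proof -
  have *: "parity_pure m (sum_list (map (gen_parity m) gs)) (foldr (right_op m c) gs vacuum)" for gs
  proof (induction gs)
    case Nil
    then show ?case by (simp add: parity_pure_def vacuum_def odd_count_def)
  next
    case (Cons g gs)
    from parity_pure_right_op[OF this, of g c] show ?case
      by (simp only: list.map sum_list.Cons foldr_Cons o_apply add.commute)
  qed
  have "foldr (right_op m c) (rev (letters w)) vacuum [] = 0" if "word_parity m w = 1" for w
  proof (rule ccontr)
    assume "foldr (right_op m c) (rev (letters w)) vacuum [] \<noteq> 0"
    with *[of "rev (letters w)"] have "odd_count m [] = sum_list (map (gen_parity m) (rev (letters w)))"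
      unfolding parity_pure_def by blast
    also have "\<dots> = 1"
      using that by (simp add: word_parity_def flip: rev_map)
    finally show False by (simp add: odd_count_def)
  qed
  with assms show ?thesis
    by (auto simp: eps_def right_act_def lin_ext_def free_part_def)
qed

section \<open>The simple module\<close>

definition coset :: "'a::ab_group_add set \<Rightarrow> 'a \<Rightarrow> 'a set" where
  "coset S x = (\<lambda>s. s + x) ` S"

definition rep :: "'a set \<Rightarrow> 'a" where
  "rep X = (SOME x. x \<in> X)"

locale additive_set =
  fixes S :: "'a::ab_group_add set"
  assumes zero: "0 \<in> S" and add: "x \<in> S \<Longrightarrow> y \<in> S \<Longrightarrow> x + y \<in> S" and neg: "x \<in> S \<Longrightarrow> - x \<in> S"
begin

lemma diff: "x \<in> S \<Longrightarrow> y \<in> S \<Longrightarrow> x - y \<in> S"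
  using add[of x "- y"] neg[of y] by simp

lemma mem_coset_iff: "y \<in> coset S x \<longleftrightarrow> y - x \<in> S"
  by (auto simp: coset_def image_iff) (metis diff_add_cancel)

lemma coset_eq_iff: "coset S x = coset S y \<longleftrightarrow> x - y \<in> S"
proof
  assume "coset S x = coset S y"
  moreover have "x \<in> coset S x" by (simp add: mem_coset_iff zero)
  ultimately show "x - y \<in> S" by (simp add: mem_coset_iff)
next
  assume xy: "x - y \<in> S"
  show "coset S x = coset S y"
  proof (rule Set.set_eqI)
    fix z show "z \<in> coset S x \<longleftrightarrow> z \<in> coset S y"
      using add[OF _ xy, of "z - x"] diff[OF _ xy, of "z - y"] by (auto simp: mem_coset_iff)
  qed
qed

lemma rep_coset: "rep (coset S x) - x \<in> S"
proof -
  have "x \<in> coset S x" by (simp add: mem_coset_iff zero)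
  then have "rep (coset S x) \<in> coset S x" unfolding rep_def by (rule someI)
  then show ?thesis by (simp add: mem_coset_iff)
qed

end

lemma (in hw_ideal) additive_set: "additive_set Q"
  by standard (simp_all add: zero add uminus)

section \<open>The grading of the free algebra\<close>

lemma word_parity_add: "word_parity m (v + w) = word_parity m v + word_parity m w"
  by (simp add: word_parity_def plus_word_def)

lemma free_part_closed:
  "0 \<in> free_part m n p" "1 \<in> free_part m n 0"
  "x \<in> free_part m n p \<Longrightarrow> y \<in> free_part m n p \<Longrightarrow> x + y \<in> free_part m n p"
  "x \<in> free_part m n p \<Longrightarrow> - x \<in> free_part m n p"
  "x \<in> free_part m n p \<Longrightarrow> y \<in> free_part m n q \<Longrightarrow> x * y \<in> free_part m n (p + q)"
  "scalar a \<in> free_part m n 0"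
  "g \<in> gens m n \<Longrightarrow> var g \<in> free_part m n (gen_parity m g)"
proof -
  show "x + y \<in> free_part m n p" if "x \<in> free_part m n p" "y \<in> free_part m n p"
    using that keys_add[of x y] unfolding free_part_def by (auto intro: free_alg_intros)
  show "x * y \<in> free_part m n (p + q)" if "x \<in> free_part m n p" "y \<in> free_part m n q"
  proof -
    have "word_parity m w = p + q" if w: "w \<in> Poly_Mapping.keys (x * y)" for w
    proof -
      from w obtain a b where "w = a + b" "a \<in> Poly_Mapping.keys x" "b \<in> Poly_Mapping.keys y"
        using keys_mult[of x y] by blast
      with \<open>x \<in> _\<close> \<open>y \<in> _\<close> show ?thesis by (auto simp: free_part_def word_parity_add)
    qed
    with that show ?thesis by (auto simp: free_part_def intro: free_alg_intros)
  qed
  show "1 \<in> free_part m n 0"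
    by (auto simp: free_part_def free_alg_1 word_parity_def zero_word_def)
qed (auto simp: free_part_def word_parity_def scalar_def var_def zero_word_def
   intro: free_alg_intros
   free_alg_scalar[unfolded scalar_def zero_word_def] free_alg_var[unfolded var_def] split: if_splits)

lemma free_part_split:
  assumes "x \<in> carrier (free_alg m n)"
  obtains x0 x1 where "x0 \<in> free_part m n 0" "x1 \<in> free_part m n 1" "x = x0 + x1"
proof -
  have "\<exists>x0\<in>free_part m n 0. \<exists>x1\<in>free_part m n 1. x = x0 + x1" using assms
  proof (induction x rule: free_alg_induct)
    case one
    show ?case by (rule bexI[of _ 1], rule bexI[of _ 0]) (simp_all add: free_part_closed)
  next
    case (mult g x)
    then obtain x0 x1 where x: "x0 \<in> free_part m n 0" "x1 \<in> free_part m n 1" "x = x0 + x1"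
      by blast
    note g = free_part_closed(5)[OF free_part_closed(7)[OF mult(1)]]
    consider "gen_parity m g = 0" | "gen_parity m g = 1" by (cases "gen_parity m g") auto
    then show ?case
    proof cases
      case 1
      with g[OF x(1)] g[OF x(2)] x(3) show ?thesis by (auto simp: distrib_left)
    next
      case 2
      with g[OF x(1)] g[OF x(2)] have "var g * x1 \<in> free_part m n 0" "var g * x0 \<in> free_part m n 1"
        by simp_all
      moreover have "var g * x = var g * x1 + var g * x0"
        by (simp add: x(3) distrib_left)
      ultimately show ?thesis by blast
    qed
  next
    case (add x y)
    then obtain x0 x1 y0 y1 where x: "x0 \<in> free_part m n 0" "x1 \<in> free_part m n 1" "x = x0 + x1"
      and y: "y0 \<in> free_part m n 0" "y1 \<in> free_part m n 1" "y = y0 + y1"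
      by blast
    show ?case
      by (rule bexI[of _ "x0 + y0"], rule bexI[of _ "x1 + y1"])
        (simp_all add: x y free_part_closed ac_simps)
  next
    case (scale a x)
    then obtain x0 x1 where x: "x0 \<in> free_part m n 0" "x1 \<in> free_part m n 1" "x = x0 + x1"
      by blast
    with free_part_closed(5)[OF free_part_closed(6) x(1), of a]
      free_part_closed(5)[OF free_part_closed(6) x(2), of a]
    show ?case by (auto simp: distrib_left)
  qed
  then show thesis using that by blast
qed

lemma free_part_subset: "free_part m n p \<subseteq> carrier (free_alg m n)"
  by (auto simp: free_part_def)

section \<open>The quantum superalgebra in terms of representatives\<close>

context weight
begin

abbreviation "J \<equiv> uq_ideal m n :: 'f free set"
abbreviation "cl \<equiv> cls m n :: 'f free \<Rightarrow> _"

lemma ideal_J: "ideal J (free_alg m n)"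
  unfolding uq_ideal_def by (rule ring.genideal_ideal[OF ring_free_alg rels_closed[OF mn]])

lemma J_mult: "x \<in> J \<Longrightarrow> y \<in> C \<Longrightarrow> x * y \<in> J" "x \<in> J \<Longrightarrow> y \<in> C \<Longrightarrow> y * x \<in> J"
  using ideal.I_l_closed[OF ideal_J, of x y] ideal.I_r_closed[OF ideal_J, of x y] by simp_all

lemma J_subset: "J \<subseteq> C"
  using uq_ideal_subset_P by (auto simp: P_def)

lemma additive_J: "additive_set J"
proof
  interpret J: ideal J "free_alg m n" by (rule ideal_J)
  show "0 \<in> J" using additive_subgroup.zero_closed[OF ideal.axioms(1)[OF ideal_J]] by simp
  show "x + y \<in> J" if "x \<in> J" "y \<in> J" for x y
    using additive_subgroup.a_closed[OF ideal.axioms(1)[OF ideal_J] that] by simp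
  show "- x \<in> J" if "x \<in> J" for x
    using J_mult(2)[OF that free_alg_scalar[of "- 1"]] by (simp add: scalar_minus scalar_1)
qed

lemma rels_J: "rels m n \<subseteq> J"
  unfolding uq_ideal_def by (rule ring.genideal_self[OF ring_free_alg rels_closed[OF mn]])

lemma cl_coset: "cl x = coset J x"
  by (auto simp: cls_def coset_def a_r_coset_def')

lemma cl_eq_iff: "cl x = cl y \<longleftrightarrow> x - y \<in> J"
  unfolding cl_coset by (rule additive_set.coset_eq_iff[OF additive_J])

lemma carrier_Uq: "carrier (Uq m n) = cl ` C"
  by (auto simp: Uq_def cls_def FactRing_def A_RCOSETS_def' )

lemma Uq_add: "x \<in> C \<Longrightarrow> y \<in> C \<Longrightarrow> cl x \<oplus>\<^bsub>Uq m n\<^esub> cl y = cl (x + y)"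
  using ring_hom_add[OF ideal.rcos_ring_hom[OF ideal_J], of x y] by (simp add: Uq_def cls_def)

lemma Uq_mult: "x \<in> C \<Longrightarrow> y \<in> C \<Longrightarrow> cl x \<otimes>\<^bsub>Uq m n\<^esub> cl y = cl (x * y)"
  using ring_hom_mult[OF ideal.rcos_ring_hom[OF ideal_J], of x y] by (simp add: Uq_def cls_def)

lemma Uq_one: "\<one>\<^bsub>Uq m n\<^esub> = cl 1"
  using ring_hom_one[OF ideal.rcos_ring_hom[OF ideal_J]] by (simp add: Uq_def cls_def)

interpretation P: hw_ideal m n c P by (rule hw_ideal_P)
interpretation PA: additive_set P by (rule P.additive_set)

text \<open>For homogeneous \<open>z'\<close> one of \<open>z' * x\<close> and \<open>z' * y\<close>
  is odd. If it is the first, \<open>eps\<close> vanishes on it; if it is the second,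
  \<open>eps\<close> takes the same value on \<open>z' * x\<close> as on
  \<open>z' * (x + y)\<close>, namely zero.\<close>

lemma P_graded:
  assumes "x \<in> free_part m n p" "y \<in> free_part m n q" "p \<noteq> q" "x + y \<in> P"
  shows "x \<in> P" "y \<in> P"
proof -
  show "x \<in> P"
    unfolding P_def
  proof (intro CollectI conjI ballI)
    show "x \<in> C" using assms(1) free_part_subset by blast
    fix z assume "z \<in> C"
    then obtain z0 z1 where z: "z0 \<in> free_part m n 0" "z1 \<in> free_part m n 1" "z = z0 + z1"
      by (rule free_part_split)
    have *: "eps m c (z' * x) = 0" if z': "z' \<in> free_part m n r" for z' r
    proof (cases "r + p = 1")
      case True
      then show ?thesis using eps_odd free_part_closed(5)[OF z' assms(1)] by metis
    next
      case False
      with assms(3) have "r + q = 1" by (cases r; cases p; cases q) auto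
      then have "eps m c (z' * y) = 0" using eps_odd free_part_closed(5)[OF z' assms(2)] by metis
      moreover have "eps m c (z' * (x + y)) = 0"
        using assms(4) z' free_part_subset unfolding P_def by blast
      ultimately show ?thesis by (simp add: distrib_left)
    qed
    show "eps m c (z * x) = 0"
      using *[OF z(1)] *[OF z(2)] by (simp add: z(3) distrib_right)
  qed
  from PA.diff[OF assms(4) this] show "y \<in> P" by simp
qed

section \<open>The quotient by \<open>P\<close> as a graded module\<close>

abbreviation "cP \<equiv> coset P"

text \<open>The ring multiplication and unit of the record are junk.\<close>

definition L :: "('f uq, 'f uq) supermodule" where
  "L = \<lparr>carrier = cP ` C, monoid.mult = (\<lambda>X Y. {}), one = {}, zero = cP 0,
     add = (\<lambda>X Y. cP (rep X + rep Y)), module.smult = (\<lambda>U X. cP (rep U * rep X)),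
     part = (\<lambda>p. cP ` free_part m n p)\<rparr>"

lemma L_simps [simp]: "carrier L = cP ` C" "\<zero>\<^bsub>L\<^esub> = cP 0" "part L p = cP ` free_part m n p"
  by (simp_all add: L_def)

lemma L_add [simp]: "cP x \<oplus>\<^bsub>L\<^esub> cP y = cP (x + y)"
  using PA.add[OF PA.rep_coset[of x] PA.rep_coset[of y]]
  by (simp add: L_def PA.coset_eq_iff algebra_simps)

lemma L_smult [simp]:
  assumes "u \<in> C" "x \<in> C" shows "cl u \<odot>\<^bsub>L\<^esub> cP x = cP (u * x)"
proof -
  \<comment> \<open>Changing representatives alters the product by
    \<open>?j * x + (?j + u) * ?p\<close>: the first summand is in the two-sided ideal
    \<open>J\<close>, the second in the left ideal \<open>P\<close>.\<close>
  let ?j = "rep (cl u) - u" and ?p = "rep (cP x) - x"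
  have j: "?j \<in> J" using additive_set.rep_coset[OF additive_J] by (simp add: cl_coset)
  have p: "?p \<in> P" by (rule PA.rep_coset)
  have "?j * x \<in> P" using J_mult(1)[OF j assms(2)] uq_ideal_subset_P by blast
  moreover have "(?j + u) * ?p \<in> P"
    using j J_subset p assms(1) by (intro P.lmult free_alg_closed(1)) auto
  ultimately have "?j * x + (?j + u) * ?p \<in> P" by (rule PA.add)
  also have "?j * x + (?j + u) * ?p = rep (cl u) * rep (cP x) - u * x"
    by (simp add: algebra_simps)
  finally show ?thesis by (simp add: L_def PA.coset_eq_iff)
qed

lemma cP_zero_iff: "cP x = cP 0 \<longleftrightarrow> x \<in> P"
  by (simp add: PA.coset_eq_iff)

lemma abelian_group_L: "abelian_group L"
proof (rule abelian_groupI)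
  show "\<exists>Y\<in>carrier L. Y \<oplus>\<^bsub>L\<^esub> X = \<zero>\<^bsub>L\<^esub>" if "X \<in> carrier L" for X
  proof -
    from that obtain x where "x \<in> C" "X = cP x" by auto
    then show ?thesis by (intro bexI[of _ "cP (- x)"]) (auto intro: free_alg_intros)
  qed
qed (auto simp: ac_simps intro: free_alg_intros)

lemma additive_subgroup_L:
  assumes "S \<subseteq> C" "0 \<in> S" "\<And>x y. x \<in> S \<Longrightarrow> y \<in> S \<Longrightarrow> x + y \<in> S" "\<And>x. x \<in> S \<Longrightarrow> - x \<in> S"
  shows "additive_subgroup (cP ` S) L"
proof (rule additive_subgroup.intro, rule group.subgroupI)
  show "Group.group (add_monoid L)"
    by (rule abelian_group.a_group[OF abelian_group_L])
  show "inv\<^bsub>add_monoid L\<^esub> X \<in> cP ` S" if "X \<in> cP ` S" for X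
  proof -
    from that obtain x where x: "x \<in> S" "X = cP x" by auto
    have "inv\<^bsub>add_monoid L\<^esub> X = cP (- x)"
      using x assms by (intro group.inv_equality abelian_group.a_group[OF abelian_group_L])
        (auto intro: free_alg_intros)
    with x assms show ?thesis by auto
  qed
qed (use assms in auto)

lemma uq_module_L: "uq_module m n L"
proof (intro uq_module.intro uq_module_axioms.intro abelian_group_L)
  show "additive_subgroup (part L p) L" for p
    by (simp, rule additive_subgroup_L) (auto intro: free_part_closed dest: free_part_subset[THEN subsetD])
  show "part L 0 <+>\<^bsub>L\<^esub> part L 1 = carrier L"
  proof
    show "part L 0 <+>\<^bsub>L\<^esub> part L 1 \<subseteq> carrier L"
      using free_part_subset by (fastforce simp: set_add_def' intro: free_alg_intros)
    show "carrier L \<subseteq> part L 0 <+>\<^bsub>L\<^esub> part L 1"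
    proof
      fix X assume "X \<in> carrier L"
      then obtain x where x: "x \<in> C" "X = cP x" by auto
      from x(1) obtain x0 x1 where "x0 \<in> free_part m n 0" "x1 \<in> free_part m n 1" "x = x0 + x1"
        by (rule free_part_split)
      then show "X \<in> part L 0 <+>\<^bsub>L\<^esub> part L 1"
        using L_add[of x0 x1] x(2) unfolding set_add_def' by force
    qed
  qed
  show "part L 0 \<inter> part L 1 = {\<zero>\<^bsub>L\<^esub>}"
  proof
    show "part L 0 \<inter> part L 1 \<subseteq> {\<zero>\<^bsub>L\<^esub>}"
    proof
      fix X assume "X \<in> part L 0 \<inter> part L 1"
      then obtain x y where x: "x \<in> free_part m n 0" "X = cP x" and y: "y \<in> free_part m n 1" "X = cP y"
        by auto
      \<comment> \<open>An element of \<open>P\<close> with even component \<open>x\<close> and odd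
        component \<open>- y\<close>, so \<open>P_graded\<close> applies.\<close>
      then have "x + - y \<in> P" using PA.coset_eq_iff[of x y] by simp
      from P_graded(1)[OF x(1) free_part_closed(4)[OF y(1)] _ this] x(2) show "X \<in> {\<zero>\<^bsub>L\<^esub>}"
        by (simp add: cP_zero_iff)
    qed
  qed (use free_part_closed(1) in auto)
  show "u \<odot>\<^bsub>L\<^esub> x \<in> part L (a + b)" if "u \<in> Uq_part m n a" "x \<in> part L b" for u x a b
  proof -
    from that obtain v y where v: "v \<in> free_part m n a" "u = cl v" and y: "y \<in> free_part m n b" "x = cP y"
      by (auto simp: Uq_part_def)
    then have "u \<odot>\<^bsub>L\<^esub> x = cP (v * y)"
      using v(1) y(1) by (simp add: free_part_subset[THEN subsetD])
    with free_part_closed(5)[OF v(1) y(1)] show ?thesis by simp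
  qed
qed (auto simp: carrier_Uq Uq_add Uq_mult Uq_one distrib_left distrib_right mult.assoc
   free_alg_closed free_alg_1)

lemma maximal_L: "maximal_vector_of_weight m n L c (cP 1)"
proof -
  have "cl (var (GK i)) \<odot>\<^bsub>L\<^esub> cP 1 = cl (scalar (c i)) \<odot>\<^bsub>L\<^esub> cP 1" if "i \<in> {1..m+n}" for i
    using P.K[OF that] that by (simp add: free_alg_gen free_alg_intros PA.coset_eq_iff)
  moreover have "cl (var (GE i)) \<odot>\<^bsub>L\<^esub> cP 1 = \<zero>\<^bsub>L\<^esub>" if "i \<in> {1..<m+n}" for i
    using P.E[OF that] that by (simp add: free_alg_gen free_alg_intros cP_zero_iff)
  moreover have "cP 1 \<noteq> \<zero>\<^bsub>L\<^esub>"
    using one_notin_P by (simp add: cP_zero_iff)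
  ultimately show ?thesis
    unfolding maximal_vector_of_weight_def weight_space_def L_simps(1,3)
    using free_part_closed(2) free_alg_1 by blast
qed

lemma highest_weight_L: "highest_weight_module m n c L"
proof -
  have "carrier L = (\<lambda>u. u \<odot>\<^bsub>L\<^esub> cP 1) ` carrier (Uq m n)"
    by (auto simp: carrier_Uq image_image free_alg_1)
  with uq_module_L maximal_L show ?thesis
    unfolding highest_weight_module_def by blast
qed

text \<open>The preimage of a submodule is a left ideal containing \<open>P\<close>, from which it
  inherits all conditions of \<open>hw_ideal\<close>; it contains 1 or, by maximality, equals
  \<open>P\<close>.\<close>

lemma simple_L: "uq_simple m n L"
  unfolding uq_simple_def
proof (intro allI impI)
  fix N assume "uq_submodule m n L N"
  then have N: "additive_subgroup N L" and act: "\<And>u x. u \<in> C \<Longrightarrow> x \<in> N \<Longrightarrow> cl u \<odot>\<^bsub>L\<^esub> x \<in> N"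
    by (auto simp: uq_submodule_def carrier_Uq)
  interpret N: additive_subgroup N L by (rule N)
  let ?Q = "{u \<in> C. cP u \<in> N}"
  have PQ: "P \<subseteq> ?Q"
    using N.zero_closed P.closed by (auto simp: cP_zero_iff[THEN iffD2])
  have Q: "hw_ideal m n c ?Q"
  proof
    show "x + y \<in> ?Q" if "x \<in> ?Q" "y \<in> ?Q" for x y
      using that N.a_closed[of "cP x" "cP y"] by (auto intro: free_alg_intros)
    show "y * x \<in> ?Q" if "y \<in> C" "x \<in> ?Q" for x y
      using that act[of y "cP x"] by (auto intro: free_alg_intros)
  qed (use P.c_nonzero P.zero P.rels P.E P.K PQ in blast)+
  show "N = {\<zero>\<^bsub>L\<^esub>} \<or> N = carrier L"
  proof (cases "1 \<in> ?Q")
    case True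
    then have "?Q = C" using hw_ideal.lmult[OF Q _ True] by auto
    then show ?thesis using N.a_subset by auto
  next
    case False
    have "X = \<zero>\<^bsub>L\<^esub>" if "X \<in> N" for X
    proof -
      from that N.a_subset obtain u where "u \<in> C" "X = cP u" by auto
      with that hw_ideal_subset_P[OF Q False] have "u \<in> P" by auto
      with \<open>X = cP u\<close> show ?thesis by (simp add: cP_zero_iff)
    qed
    with N.zero_closed show ?thesis by blast
  qed
qed

end

section \<open>Maximal vectors and uniqueness\<close>

context weight begin

interpretation P: hw_ideal m n c P by (rule hw_ideal_P)
interpretation PA: additive_set P by (rule P.additive_set)

lemma eps_Fspan_mult:
  assumes "p \<in> Fspan m n" shows "eps m c (p * u) = Poly_Mapping.lookup p 0 * eps m c u"
proof -
  obtain S b where S: "finite S" "[] \<notin> S"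
    "p = scalar (Poly_Mapping.lookup p 0) + (\<Sum>w\<in>S. scalar (b w) * fmon w)"
    by (rule Fspan_decompose[OF assms]) blast
  have fmon: "eps m c (fmon w * u) = 0" if "w \<noteq> []" for w
    using that by (cases w) (simp_all add: fmon_Cons eps_def F_op_vacuum right_rep_zero)
  have "eps m c ((\<Sum>w\<in>S. scalar (b w) * fmon w) * u) = 0"
    using S(1,2)
  proof (induction S rule: finite_induct)
    case (insert w S)
    then have "w \<noteq> []" by auto
    with insert show ?case by (simp add: fmon distrib_right mult.assoc)
  qed simp
  then show ?thesis
    by (subst S(3)) (simp add: distrib_right)
qed

text \<open>The annihilator of the class of \<open>u\<close>. It allows the reduction to lowering
  words to be used for a singular vector of any weight \<open>d\<close>, not only for the
  generator.\<close>

lemma hw_ideal_quotient: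
  assumes "d \<in> weights m n" "u \<in> C"
    and E: "\<And>i. i \<in> {1..<m+n} \<Longrightarrow> var (GE i) * u \<in> P"
    and K: "\<And>i. i \<in> {1..m+n} \<Longrightarrow> (var (GK i) - scalar (d i)) * u \<in> P"
  shows "hw_ideal m n d {z \<in> C. z * u \<in> P}"
proof
  show "d i \<noteq> 0" if "i \<in> {1..m+n}" for i using assms(1) that by (auto simp: weights_def)
  show "x + y \<in> {z \<in> C. z * u \<in> P}" if "x \<in> {z \<in> C. z * u \<in> P}" "y \<in> {z \<in> C. z * u \<in> P}" for x y
    using that by (auto simp: distrib_right free_alg_closed P.add)
  show "y * x \<in> {z \<in> C. z * u \<in> P}" if "y \<in> C" "x \<in> {z \<in> C. z * u \<in> P}" for x y
    using that by (auto simp: mult.assoc free_alg_closed P.lmult)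
  show "r * z \<in> {z \<in> C. z * u \<in> P}"
    if r: "r \<in> rels_K m n \<union> rels_KEF m n \<union> rels_EF m n" and z: "z \<in> C" for r z
  proof -
    have "r \<in> C" using r rels_closed[OF mn, where 'f = 'f] by (auto simp: rels_def)
    then show ?thesis
      using z assms(2) P.rels[OF r, of "z * u"] by (simp add: mult.assoc free_alg_closed)
  qed
  show "var (GE i) \<in> {z \<in> C. z * u \<in> P}" if "i \<in> {1..<m+n}" for i
    using that E by (auto intro: free_alg_gen)
  show "var (GK i) - scalar (d i) \<in> {z \<in> C. z * u \<in> P}" if "i \<in> {1..m+n}" for i
    using that K by (auto intro!: free_alg_gen free_alg_closed(3) free_alg_scalar)
qed (use P.zero free_alg_0 in auto)

text \<open>If \<open>u\<close> represents a maximal vector, then \<open>z * u\<close> reduces to a combination of words in the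
  $F_{j,j+1}$ times \<open>u\<close>, on which \<open>eps\<close> sees only the empty word.\<close>

lemma singular_in_P:
  assumes "hw_ideal m n d {z \<in> C. z * u \<in> P}" "u \<in> C" "eps m c u = 0"
  shows "u \<in> P"
proof -
  interpret D: hw_ideal m n d "{z \<in> C. z * u \<in> P}" by fact
  have "eps m c (z * u) = 0" if "z \<in> C" for z
  proof -
    from D.all_reducible[OF that] obtain p where p: "p \<in> Fspan m n" "(z - p) * u \<in> P"
      unfolding D.reducible_def D.cong_def by blast
    from p(2) have "eps m c (1 * ((z - p) * u)) = 0"
      unfolding P_def using free_alg_1 by blast
    then show ?thesis
      by (simp add: left_diff_distrib eps_Fspan_mult[OF p(1)] assms(3))
  qed
  with assms(2) show ?thesis by (simp add: P_def)
qed

text \<open>The functional cannot vanish on a representative \<open>u\<close>, or \<open>u\<close>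
  would lie in \<open>P\<close>. Evaluating it on \<open>K_i * u\<close> forces the weight to be
  \<open>c\<close>, and then subtracting a multiple of the generator gives a singular vector with
  value 0.\<close>

lemma maximal_vector_L:
  assumes "maximal_vector m n L y"
  shows "\<exists>a. a \<noteq> 0 \<and> y = cl (scalar a) \<odot>\<^bsub>L\<^esub> cP 1"
proof -
  from assms obtain d where d: "d \<in> weights m n" and y: "maximal_vector_of_weight m n L d y"
    unfolding maximal_vector_def by blast
  then obtain u where u: "u \<in> C" "y = cP u"
    unfolding maximal_vector_of_weight_def weight_space_def by auto
  have E: "var (GE i) * u \<in> P" if "i \<in> {1..<m+n}" for i
  proof -
    have "cl (var (GE i)) \<odot>\<^bsub>L\<^esub> y = \<zero>\<^bsub>L\<^esub>"
      using y that unfolding maximal_vector_of_weight_def by blast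
    with u that show ?thesis by (simp add: free_alg_gen cP_zero_iff)
  qed
  have K: "(var (GK i) - scalar (d i)) * u \<in> P" if "i \<in> {1..m+n}" for i
  proof -
    have "cl (var (GK i)) \<odot>\<^bsub>L\<^esub> y = cl (scalar (d i)) \<odot>\<^bsub>L\<^esub> y"
      using y that unfolding maximal_vector_of_weight_def weight_space_def by blast
    with u that show ?thesis
      by (simp add: free_alg_gen free_alg_scalar PA.coset_eq_iff left_diff_distrib)
  qed
  define e where "e = eps m c u"
  have "e \<noteq> 0"
  proof
    assume "e = 0"
    then have "u \<in> P"
      using singular_in_P[OF hw_ideal_quotient[OF d u(1) E K] u(1)] by (simp add: e_def)
    with y u(2) show False
      by (simp add: maximal_vector_of_weight_def cP_zero_iff)
  qed
  have dc: "d i = c i" if "i \<in> {1..m+n}" for i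
  proof -
    have "eps m c (1 * ((var (GK i) - scalar (d i)) * u)) = 0"
      using K[OF that] free_alg_1 unfolding P_def by blast
    moreover have "eps m c (var (GK i) * u) = c i * eps m c u"
      by (simp add: eps_def K_op_vacuum linear_op_scale[OF right_act_linear[OF linear_right_op]])
    ultimately show ?thesis using \<open>e \<noteq> 0\<close> by (simp add: left_diff_distrib e_def)
  qed
  let ?v = "u - scalar e"
  have v: "?v \<in> C" using u(1) by (intro free_alg_intros)
  \<comment> \<open>Both \<open>u\<close> and 1 represent vectors killed by the raising generators
    and, as \<open>d\<close> agrees with \<open>c\<close>, of the same weight; so their combination
    \<open>?v\<close> does too.\<close>
  have "var (GE i) * ?v \<in> P" if "i \<in> {1..<m+n}" for i
    using PA.diff[OF E[OF that] P.lmult[OF free_alg_scalar[of e] P.E[OF that]]]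
    by (simp add: right_diff_distrib scalar_commute)
  moreover have "(var (GK i) - scalar (d i)) * ?v \<in> P" if "i \<in> {1..m+n}" for i
    using PA.diff[OF K[OF that] P.lmult[OF free_alg_scalar[of e] P.K[OF that]]]
    by (simp add: right_diff_distrib left_diff_distrib scalar_commute[of e] dc[OF that])
  ultimately have "hw_ideal m n d {z \<in> C. z * ?v \<in> P}"
    by (rule hw_ideal_quotient[OF d v])
  then have "?v \<in> P"
    by (rule singular_in_P[OF _ v]) (simp add: e_def)
  then have "y = cP (scalar e)"
    using u(2) by (simp add: PA.coset_eq_iff)
  then show ?thesis
    using \<open>e \<noteq> 0\<close> by (intro exI[of _ e]) (simp add: free_alg_scalar free_alg_1)
qed

text \<open>Let the free algebra act on the generating vector \<open>x\<close>. The kernel is a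
  proper left ideal of highest weight type, hence inside \<open>P\<close>. The image of
  \<open>P\<close> is then a proper graded submodule, so it vanishes by simplicity and the kernel is
  exactly \<open>P\<close>.\<close>

lemma L_unique:
  fixes M :: "('f uq, 'v) supermodule"
  assumes "highest_weight_module m n c M" "uq_simple m n M"
  shows "uq_isomorphic m n L M"
proof -
  interpret M: uq_module m n M
    using assms(1) by (simp add: highest_weight_module_def)
  obtain x where max: "maximal_vector_of_weight m n M c x"
    and gen: "carrier M = (\<lambda>u. u \<odot>\<^bsub>M\<^esub> x) ` carrier (Uq m n)"
    using assms(1) by (auto simp: highest_weight_module_def)
  from max obtain p0 where x: "x \<in> carrier M" "x \<noteq> \<zero>\<^bsub>M\<^esub>" "x \<in> part M p0"
    by (auto simp: maximal_vector_of_weight_def weight_space_def)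
  define act where "act u = cl u \<odot>\<^bsub>M\<^esub> x" for u
  have cU: "cl u \<in> carrier (Uq m n)" if "u \<in> C" for u
    using that by (simp add: carrier_Uq)
  have actC: "act u \<in> carrier M" if "u \<in> C" for u
    unfolding act_def using cU[OF that] x(1) by (rule M.smult_closed)
  have act_add: "act (u + v) = act u \<oplus>\<^bsub>M\<^esub> act v" if "u \<in> C" "v \<in> C" for u v
    unfolding act_def using M.smult_l_distr[OF cU[OF that(1)] cU[OF that(2)] x(1)] that
    by (simp add: Uq_add)
  have act_mult: "act (u * v) = cl u \<odot>\<^bsub>M\<^esub> act v" if "u \<in> C" "v \<in> C" for u v
    unfolding act_def using M.smult_assoc[OF cU[OF that(1)] cU[OF that(2)] x(1)] that
    by (simp add: Uq_mult)
  have act_1: "act 1 = x"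
    unfolding act_def using M.smult_one[OF x(1)] by (simp add: Uq_one)
  have act_0: "act 0 = \<zero>\<^bsub>M\<^esub>"
    using act_add[OF free_alg_0 free_alg_0] actC[OF free_alg_0] M.add.l_cancel_one[of "act 0" "act 0"] by simp
  have act_uminus: "act (- u) = \<ominus>\<^bsub>M\<^esub> act u" if "u \<in> C" for u
    using act_add[OF free_alg_closed(2)[OF that that] that] that act_0 actC[of u]
      actC[OF free_alg_closed(2)[OF that that]]
    by (intro M.minus_equality[symmetric]) auto
  have smult_0: "cl u \<odot>\<^bsub>M\<^esub> \<zero>\<^bsub>M\<^esub> = \<zero>\<^bsub>M\<^esub>" if "u \<in> C" for u
    using act_mult[OF that free_alg_0] act_0 by simp
  have act_J: "act u = \<zero>\<^bsub>M\<^esub>" if "u \<in> J" for u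
  proof -
    have "cl u = cl 0" using that by (simp add: cl_eq_iff)
    then show ?thesis using act_0 by (simp add: act_def)
  qed
  have carr: "carrier M = act ` C"
    unfolding gen carrier_Uq act_def by auto
  have act_part: "act u \<in> part M (p + p0)" if "u \<in> free_part m n p" for u p
    unfolding act_def using that x(3) by (intro M.part_smult) (auto simp: Uq_part_def)
  have partC: "part M p \<subseteq> carrier M" for p
    using additive_subgroup.a_subset[OF M.part_subgroup] .

  let ?Z = "{u \<in> C. act u = \<zero>\<^bsub>M\<^esub>}"
  have Z: "hw_ideal m n c ?Z"
  proof
    show "u + v \<in> ?Z" if "u \<in> ?Z" "v \<in> ?Z" for u v
      using that by (auto simp: act_add intro: free_alg_intros)
    show "v * u \<in> ?Z" if "v \<in> C" "u \<in> ?Z" for u v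
      using that by (auto simp: act_mult smult_0 intro: free_alg_intros)
    show "r * z \<in> ?Z" if r: "r \<in> rels_K m n \<union> rels_KEF m n \<union> rels_EF m n" and z: "z \<in> C" for r z
    proof -
      have "r * z \<in> J" using r z rels_J by (intro J_mult) (auto simp: rels_def)
      then show ?thesis using act_J J_subset by auto
    qed
    show "var (GE i) \<in> ?Z" if "i \<in> {1..<m+n}" for i
      using max that by (auto simp: act_def maximal_vector_of_weight_def intro: free_alg_gen)
    show "var (GK i) - scalar (c i) \<in> ?Z" if i: "i \<in> {1..m+n}" for i
    proof -
      have KC: "var (GK i) \<in> C" "scalar (c i) \<in> C" "- scalar (c i) \<in> C"
        using i by (auto intro!: free_alg_gen free_alg_scalar free_alg_closed(2))
      have "act (var (GK i)) = act (scalar (c i))"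
        using max i by (simp add: act_def maximal_vector_of_weight_def weight_space_def)
      then have "act (var (GK i) + - scalar (c i)) = \<zero>\<^bsub>M\<^esub>"
        using KC actC by (simp only: act_add act_uminus M.r_neg)
      with KC show ?thesis by (simp add: free_alg_closed)
    qed
  qed (use c_nonzero act_0 free_alg_0 in auto)
  have "1 \<notin> ?Z" using act_1 x(2) by simp
  with Z have ZP: "?Z \<subseteq> P" by (rule hw_ideal_subset_P)

  have PC: "u \<in> C" if "u \<in> P" for u using P.closed that by blast
  have sub: "uq_submodule m n M (act ` P)"
    unfolding uq_submodule_def
  proof (intro conjI ballI)
    show "additive_subgroup (act ` P) M"
    proof (rule additive_subgroup.intro, rule group.subgroupI)
      show "inv\<^bsub>add_monoid M\<^esub> a \<in> act ` P" if "a \<in> act ` P" for a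
      proof -
        from that obtain u where u: "u \<in> P" "a = act u" by blast
        with P.closed have "inv\<^bsub>add_monoid M\<^esub> a = act (- u)"
          using act_uminus[of u] by (auto simp: a_inv_def)
        with PA.neg[OF u(1)] show ?thesis by blast
      qed
      show "a \<otimes>\<^bsub>add_monoid M\<^esub> b \<in> act ` P" if "a \<in> act ` P" "b \<in> act ` P" for a b
      proof -
        from that obtain u v where u: "u \<in> P" "a = act u" "v \<in> P" "b = act v" by blast
        then have "a \<otimes>\<^bsub>add_monoid M\<^esub> b = act (u + v)"
          by (simp add: act_add PC)
        with PA.add[OF u(1,3)] show ?thesis by blast
      qed
    qed (use M.a_group PA.zero P.closed actC in auto)
    show "U \<odot>\<^bsub>M\<^esub> y \<in> act ` P" if "U \<in> carrier (Uq m n)" "y \<in> act ` P" for U y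
    proof -
      from that obtain u v where u: "u \<in> C" "U = cl u" "v \<in> P" "y = act v"
        by (auto simp: carrier_Uq)
      then have "U \<odot>\<^bsub>M\<^esub> y = act (u * v)"
        by (simp add: act_mult PC)
      with P.lmult[OF u(1,3)] show ?thesis by blast
    qed
    show "act ` P = (act ` P \<inter> part M 0) <+>\<^bsub>M\<^esub> (act ` P \<inter> part M 1)"
    proof
      show "act ` P \<subseteq> (act ` P \<inter> part M 0) <+>\<^bsub>M\<^esub> (act ` P \<inter> part M 1)"
      proof
        fix y assume "y \<in> act ` P"
        then obtain u where u: "u \<in> P" "y = act u" by blast
        with P.closed have "u \<in> C" by blast
        then obtain u0 u1 where s: "u0 \<in> free_part m n 0" "u1 \<in> free_part m n 1" "u = u0 + u1"
          by (rule free_part_split)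
        have uP: "u0 \<in> P" "u1 \<in> P"
          using P_graded[OF s(1,2)] u(1) s(3) by auto
        \<comment> \<open>Both orders are recorded because the parity \<open>p0\<close> of
          \<open>x\<close> decides which of the two components lies in
          \<open>part M 0\<close>.\<close>
        then have y: "y = act u0 \<oplus>\<^bsub>M\<^esub> act u1" "y = act u1 \<oplus>\<^bsub>M\<^esub> act u0"
          using act_add[OF PC PC, of u0 u1] act_add[OF PC PC, of u1 u0] u(2) s(3)
          by (simp_all add: add.commute)
        consider "p0 = 0" | "p0 = 1" by (cases p0) auto
        then show "y \<in> (act ` P \<inter> part M 0) <+>\<^bsub>M\<^esub> (act ` P \<inter> part M 1)"
        proof cases
          case 1
          with act_part[OF s(1)] act_part[OF s(2)] uP y(1) show ?thesis
            unfolding set_add_def' by auto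
        next
          case 2
          with act_part[OF s(1)] act_part[OF s(2)] uP y(2) show ?thesis
            unfolding set_add_def' by auto
        qed
      qed
      show "(act ` P \<inter> part M 0) <+>\<^bsub>M\<^esub> (act ` P \<inter> part M 1) \<subseteq> act ` P"
      proof
        fix y assume "y \<in> (act ` P \<inter> part M 0) <+>\<^bsub>M\<^esub> (act ` P \<inter> part M 1)"
        then obtain u v where u: "u \<in> P" "v \<in> P" "y = act u \<oplus>\<^bsub>M\<^esub> act v"
          unfolding set_add_def' by auto
        then have "y = act (u + v)" by (simp add: act_add PC)
        with PA.add[OF u(1,2)] show "y \<in> act ` P" by blast
      qed
    qed
  qed
  have "act ` P \<noteq> carrier M"
  proof
    assume "act ` P = carrier M"
    \<comment> \<open>If \<open>x\<close> is the image of \<open>p\<close> in \<open>P\<close>, then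
      \<open>1 - p\<close> annihilates \<open>x\<close>, so it lies in \<open>P\<close> and so does
      1.\<close>
    with x(1) obtain p where p: "p \<in> P" "x = act p" by blast
    with P.closed have pC: "p \<in> C" "- p \<in> C" by (auto intro: free_alg_intros)
    have "act (1 + - p) = \<zero>\<^bsub>M\<^esub>"
      using act_add[OF free_alg_1 pC(2)] act_uminus[OF pC(1)] act_1 p(2) M.r_neg[OF x(1)] by simp
    then have "1 + - p \<in> P"
      using ZP free_alg_closed(1)[OF free_alg_1 pC(2)] by blast
    from PA.add[OF this p(1)] show False using one_notin_P by simp
  qed
  with assms(2) sub have "act ` P = {\<zero>\<^bsub>M\<^esub>}"
    unfolding uq_simple_def by blast
  then have PZ: "u \<in> P \<Longrightarrow> act u = \<zero>\<^bsub>M\<^esub>" for u by blast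
  have act_eq: "act u = act v \<longleftrightarrow> u - v \<in> P" if uv: "u \<in> C" "v \<in> C" for u v
  proof -
    have uvC: "u - v \<in> C" using uv by (rule free_alg_closed(3))
    have "act u = act (u - v) \<oplus>\<^bsub>M\<^esub> act v"
      using act_add[OF uvC uv(2)] by simp
    then have "act u = act v \<longleftrightarrow> act (u - v) = \<zero>\<^bsub>M\<^esub>"
      using actC[OF uvC] actC[OF uv(2)] by auto
    with PZ ZP uvC show ?thesis by blast
  qed
  define f where "f X = act (rep X)" for X
  have f: "f (cP u) = act u" if "u \<in> C" for u
  proof -
    have r: "rep (cP u) - u \<in> P" by (rule PA.rep_coset)
    then have "rep (cP u) - u + u \<in> C" using P.closed that by (intro free_alg_closed(1)) auto
    then show ?thesis unfolding f_def using act_eq[of "rep (cP u)" u] that r by simp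
  qed
  have fpart: "f ` part L p = act ` free_part m n p" for p
    using f free_part_subset by (force simp: image_image)
  have part_eq: "act ` free_part m n p = part M (p + p0)" for p
  proof
    show "act ` free_part m n p \<subseteq> part M (p + p0)" using act_part by blast
    show "part M (p + p0) \<subseteq> act ` free_part m n p"
    proof
      fix y assume y: "y \<in> part M (p + p0)"
      with partC carr obtain u where u: "u \<in> C" "y = act u" by blast
      from u(1) obtain u0 u1 where s: "u0 \<in> free_part m n 0" "u1 \<in> free_part m n 1" "u = u0 + u1"
        by (rule free_part_split)
      \<comment> \<open>\<open>v\<close> is the component of \<open>u\<close> of the wanted parity.
        The image of \<open>w\<close> lies in the opposite part of \<open>M\<close>, and as a
        difference also in the same part as \<open>y\<close>, so it is zero.\<close>
      obtain v w where v: "v \<in> free_part m n p" and w: "w \<in> free_part m n (p + 1)" and vw: "u = v + w"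
        using s by (cases p) (auto simp: add.commute)
      have vwC: "v \<in> C" "w \<in> C" using v w free_part_subset by blast+
      have yv: "y = act v \<oplus>\<^bsub>M\<^esub> act w" using act_add[OF vwC] vw u(2) by simp
      interpret pt: additive_subgroup "part M (p + p0)" M by (rule M.part_subgroup)
      have "act w = y \<ominus>\<^bsub>M\<^esub> act v"
        using yv actC[OF vwC(1)] actC[OF vwC(2)]
        by (simp add: M.minus_eq M.a_comm[of "act v" "act w"] M.a_assoc M.r_neg)
      also have "\<dots> \<in> part M (p + p0)"
        unfolding M.minus_eq by (intro pt.a_closed pt.a_inv_closed y act_part v)
      finally have "act w \<in> part M (p + p0)" .
      moreover have "act w \<in> part M (p + 1 + p0)" by (rule act_part[OF w])
      ultimately have "act w \<in> part M 0 \<inter> part M 1"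
        by (cases p; cases p0) auto
      then have "act w = \<zero>\<^bsub>M\<^esub>" using M.part_disjoint by blast
      with yv actC[OF vwC(1)] have "y = act v" by simp
      with v show "y \<in> act ` free_part m n p" by blast
    qed
  qed
  have "uq_iso m n L M f"
    unfolding uq_iso_def
  proof (intro conjI ballI)
    show "bij_betw f (carrier L) (carrier M)"
      unfolding bij_betw_def
    proof
      show "inj_on f (carrier L)"
      proof (rule inj_onI)
        fix X Y assume XY: "X \<in> carrier L" "Y \<in> carrier L" "f X = f Y"
        then obtain u v where "u \<in> C" "X = cP u" "v \<in> C" "Y = cP v" by auto
        with XY(3) show "X = Y" by (simp add: f act_eq PA.coset_eq_iff)
      qed
      show "f ` carrier L = carrier M"
        unfolding carr by (force simp: image_image f)
    qed
    show "f (X \<oplus>\<^bsub>L\<^esub> Y) = f X \<oplus>\<^bsub>M\<^esub> f Y" if "X \<in> carrier L" "Y \<in> carrier L" for X Y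
      using that by (auto simp: f act_add free_alg_closed)
    show "f (U \<odot>\<^bsub>L\<^esub> X) = U \<odot>\<^bsub>M\<^esub> f X" if "U \<in> carrier (Uq m n)" "X \<in> carrier L" for U X
      using that by (auto simp: carrier_Uq f act_mult free_alg_closed)
    \<comment> \<open>The even class of 1 goes to \<open>x\<close>, so parities are preserved for
      \<open>p0 = 0\<close> and interchanged for \<open>p0 = 1\<close>.\<close>
    show "(\<forall>p. f ` part L p = part M p) \<or> (\<forall>p. f ` part L p = part M (p + 1))"
      unfolding fpart part_eq by (cases p0) auto
  qed
  then show ?thesis unfolding uq_isomorphic_def by blast
qed

end

theorem theorem6p3:
  fixes m n :: nat and c :: "nat \<Rightarrow> 'f::field_char_0 ratfun"
  assumes "1 \<le> m" and "1 \<le> n" and "c \<in> weights m n"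
  shows "\<exists>L :: ('f uq, 'f uq) supermodule.
      highest_weight_module m n c L \<and> uq_simple m n L
      \<and> (\<forall>M :: ('f uq, 'v) supermodule.
            highest_weight_module m n c M \<and> uq_simple m n M \<longrightarrow> uq_isomorphic m n L M)
      \<and> (\<exists>x. maximal_vector m n L x
            \<and> (\<forall>y. maximal_vector m n L y \<longrightarrow>
                  (\<exists>a. a \<noteq> 0 \<and> y = cls m n (scalar a) \<odot>\<^bsub>L\<^esub> x)))"
proof -
  interpret weight m n c using assms by unfold_locales
  have "maximal_vector m n L (coset P 1)"
    using maximal_L assms(3) unfolding maximal_vector_def by blast
  then show ?thesis
    using highest_weight_L simple_L L_unique maximal_vector_L by blast
qed

end
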